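(* Any Tychonoff space $X$ is closely embedded into a pseudocompact Ascoli space $Y$ such that (i) $Y$ is not a $k_{\mathbb{R}}$-space; (ii) $w(Y)= \max\{w(X), \aleph_2\}$; (iii) if, in addition, $X$ is $\omega$-bounded (respectively, sequentially compact, totally countably compact, near sequentially compact, or countably compact), then so is $Y$.
   Context: All spaces are assumed to be Tychonoff. $w(Z)$ denotes the weight of a space $Z$. $X$ is closely embedded into $Y$ if there is a homeomorphic embedding $f:X\to Y$ whose image $f(X)$ is a closed subspace of $Y$. A space is pseudocompact if every continuous real-valued function on it is bounded. $C_k(Y)$ denotes the space of all continuous real-valued functions on $Y$ with the compact-open topology; $Y$ is Ascoli if for every compact $\mathcal{K}\subseteq C_k(Y)$ the map $Y\times\mathcal{K}\ni(y,f)\mapsto f(y)$ is continuous. A function $f:Y\to\mathbb{R}$ is $k$-continuous if its restriction to every compact subset of $Y$ is continuous; $Y$ is a $k_{\mathbb{R}}$-space if every $k$-continuous $f:Y\to\mathbb{R}$ is continuous. A space $Z$ is: sequentially compact if every sequence in $Z$ has a convergent subsequence; $\omega$-bounded if every sequence in $Z$ has compact closure; totally countably compact if every sequence in $Z$ has a subsequence with compact closure; near sequentially compact if for any sequence $(U_n)_{n\in\omega}$ of nonempty open sets in $Z$ there exists a sequence $(x_n)_{n\in\omega}\in\prod_{n\in\omega}U_n$ containing a convergent subsequence; countably compact if every sequence in $Z$ has a cluster point. *)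

theory Defs
  imports "HOL-Analysis.Analysis"
begin

unbundle cardinal_syntax

definition tychonoff_space :: "'a topology \<Rightarrow> bool" where
  "tychonoff_space X \<longleftrightarrow> completely_regular_space X \<and> Hausdorff_space X"

definition closely_embedded :: "'a topology \<Rightarrow> 'b topology \<Rightarrow> bool" where
  "closely_embedded X Y \<longleftrightarrow> (\<exists>f. embedding_map X Y f \<and> closedin Y (f ` topspace X))"


subsection \<open>Weight\<close>

definition is_base :: "'a topology \<Rightarrow> 'a set set \<Rightarrow> bool" where
  "is_base X B \<longleftrightarrow> (\<forall>V\<in>B. openin X V) \<and>
     (\<forall>U x. openin X U \<and> x \<in> U \<longrightarrow> (\<exists>V\<in>B. x \<in> V \<and> V \<subseteq> U))"

definition is_min_base :: "'a topology \<Rightarrow> 'a set set \<Rightarrow> bool" where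
  "is_min_base X B \<longleftrightarrow> is_base X B \<and> (\<forall>B'. is_base X B' \<longrightarrow> |B| \<le>o |B'| )"

text \<open>Cardinals are wellorders in the sense of \<^theory>\<open>HOL.BNF_Cardinal_Order_Relation\<close>,
  to be compared up to order isomorphism (\<open>=o\<close>).\<close>

definition weight :: "'a topology \<Rightarrow> 'a set rel" where
  "weight X = |SOME B. is_min_base X B|"

lemma is_base_openin: "is_base X {U. openin X U}"
  unfolding is_base_def by blast

lemma is_min_base_exists: "\<exists>B. is_min_base X B"
proof -
  let ?R = "card_of ` {B. is_base X B}"
  have ne: "?R \<noteq> {}"
    using is_base_openin by fast
  have co: "\<forall>r\<in>?R. Card_order r"
    by (simp add: card_of_Card_order)
  obtain r where r: "r \<in> ?R" "\<forall>r'\<in>?R. r \<le>o r'"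
    using exists_minim_Card_order[OF ne co] by (elim bexE)
  from r(1) obtain B where "is_base X B" "r = |B|"
    by (elim imageE) simp
  with r(2) show ?thesis
    by (intro exI[of _ B]) (simp add: is_min_base_def)
qed

lemma weight_attained: "\<exists>B. is_min_base X B \<and> weight X = |B|"
  unfolding weight_def
  by (intro exI[of _ "SOME B. is_min_base X B"] conjI someI_ex[OF is_min_base_exists] refl)

definition aleph_2 :: "nat set set rel" where
  "aleph_2 = cardSuc (cardSuc natLeq)"

text \<open>\<open>r = max {s, t}\<close> for cardinals whose underlying types may differ.\<close>

definition is_card_max :: "'r rel \<Rightarrow> 's rel \<Rightarrow> 't rel \<Rightarrow> bool" where
  "is_card_max r s t \<longleftrightarrow> s \<le>o r \<and> t \<le>o r \<and> (r =o s \<or> r =o t)"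


subsection \<open>The function space \<open>C\<^sub>k(Y)\<close>, Ascoli spaces and \<open>k\<^sub>\<real>\<close>-spaces\<close>

text \<open>Functions are extensional, so that each continuous function on the space
  \<open>Y\<close> is represented exactly once.\<close>

definition Ck_carrier :: "'a topology \<Rightarrow> ('a \<Rightarrow> real) set" where
  "Ck_carrier Y = {f \<in> extensional (topspace Y). continuous_map Y euclideanreal f}"

definition Ck :: "'a topology \<Rightarrow> ('a \<Rightarrow> real) topology" where
  "Ck Y = topology_generated_by
     {{f \<in> Ck_carrier Y. f ` K \<subseteq> U} | K U. compactin Y K \<and> open U}"

lemma topspace_Ck: "topspace (Ck Y) = Ck_carrier Y"
proof -
  let ?S = "{{f \<in> Ck_carrier Y. f ` K \<subseteq> U} | K U. compactin Y K \<and> open U}"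
  have "{f \<in> Ck_carrier Y. f ` {} \<subseteq> UNIV} \<in> ?S"
    by (intro CollectI exI[of _ "{}"] exI[of _ UNIV] conjI refl) simp_all
  then have "Ck_carrier Y \<subseteq> \<Union>?S"
    by (intro Union_upper) simp
  moreover have "\<Union>?S \<subseteq> Ck_carrier Y"
    by (intro Union_least) auto
  ultimately show ?thesis
    unfolding Ck_def topology_generated_by_topspace by (rule equalityI[rotated])
qed

definition ascoli_space :: "'a topology \<Rightarrow> bool" where
  "ascoli_space Y \<longleftrightarrow>
     (\<forall>\<K>. compactin (Ck Y) \<K> \<longrightarrow>
        continuous_map (prod_topology Y (subtopology (Ck Y) \<K>)) euclideanreal
          (\<lambda>(y, f). f y))"

definition k_continuous :: "'a topology \<Rightarrow> ('a \<Rightarrow> real) \<Rightarrow> bool" where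
  "k_continuous Y f \<longleftrightarrow>
     (\<forall>K. compactin Y K \<longrightarrow> continuous_map (subtopology Y K) euclideanreal f)"

definition k_real_space :: "'a topology \<Rightarrow> bool" where
  "k_real_space Y \<longleftrightarrow> (\<forall>f. k_continuous Y f \<longrightarrow> continuous_map Y euclideanreal f)"


subsection \<open>Compactness-type properties\<close>

definition pseudocompact_space :: "'a topology \<Rightarrow> bool" where
  "pseudocompact_space Z \<longleftrightarrow>
     (\<forall>f. continuous_map Z euclideanreal f \<longrightarrow> bounded (f ` topspace Z))"

definition sequentially_compact_space :: "'a topology \<Rightarrow> bool" where
  "sequentially_compact_space Z \<longleftrightarrow>
     (\<forall>x :: nat \<Rightarrow> 'a. range x \<subseteq> topspace Z \<longrightarrow>
        (\<exists>r l. strict_mono r \<and> limitin Z (x \<circ> r) l sequentially))"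

definition omega_bounded_space :: "'a topology \<Rightarrow> bool" where
  "omega_bounded_space Z \<longleftrightarrow>
     (\<forall>x :: nat \<Rightarrow> 'a. range x \<subseteq> topspace Z \<longrightarrow> compactin Z (Z closure_of range x))"

definition totally_countably_compact_space :: "'a topology \<Rightarrow> bool" where
  "totally_countably_compact_space Z \<longleftrightarrow>
     (\<forall>x :: nat \<Rightarrow> 'a. range x \<subseteq> topspace Z \<longrightarrow>
        (\<exists>r :: nat \<Rightarrow> nat. strict_mono r \<and> compactin Z (Z closure_of range (x \<circ> r))))"

definition near_sequentially_compact_space :: "'a topology \<Rightarrow> bool" where
  "near_sequentially_compact_space Z \<longleftrightarrow>
     (\<forall>U :: nat \<Rightarrow> 'a set. (\<forall>n. openin Z (U n) \<and> U n \<noteq> {}) \<longrightarrow>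
        (\<exists>x. (\<forall>n. x n \<in> U n) \<and>
             (\<exists>r l. strict_mono r \<and> limitin Z (x \<circ> r) l sequentially)))"

definition countably_compact_space :: "'a topology \<Rightarrow> bool" where
  "countably_compact_space Z \<longleftrightarrow>
     (\<forall>x :: nat \<Rightarrow> 'a. range x \<subseteq> topspace Z \<longrightarrow>
        (\<exists>l\<in>topspace Z. \<forall>U. openin Z U \<and> l \<in> U \<longrightarrow> infinite {n. x n \<in> U}))"


subsection \<open>A host type for the extension\<close>

text \<open>HOL cannot quantify existentially over types, so the points of \<open>Y\<close> must come from
  a type fixed in advance.  The one below loses no generality.  A Tychonoff space \<open>Y\<close>
  embeds into the cube of exponent \<open>w(Y)\<close>, and if \<open>w(Y) \<le> max {w(X), \<aleph>\<^sub>2}\<close> for a space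
  \<open>X\<close> on type \<open>'a\<close>, then \<open>w(Y)\<close> is at most the cardinality of
  \<open>'a set + nat set set\<close>, as \<open>w(X) \<le> 2\<^bsup>|'a|\<^esup>\<close> and \<open>\<aleph>\<^sub>2 \<le> 2\<^bsup>2\<^bsup>\<aleph>\<^sub>0\<^esup>\<^esup>\<close>.
  Hence every such \<open>Y\<close> is homeomorphic to a space whose points are of this type.\<close>

type_synonym 'a cube = "'a set + nat set set \<Rightarrow> real"

end

theory Submission
  imports Defs "HOL-Library.Countable_Set_Type"
begin

text \<open>Let \<open>\<Sigma> \<subseteq> [0,1]\<^bsup>J\<^esup>\<close> consist of the points with countable support, where \<open>J\<close> is the disjoint
  union of a set \<open>W\<close> of cardinality \<open>\<aleph>\<^sub>2\<close> and a set of at most \<open>max {w(X), \<aleph>\<^sub>2}\<close> coordinates in which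
  \<open>X\<close> embeds.  Put \<open>Y = \<Sigma> \<union> F\<close>, where \<open>F\<close> is the copy of \<open>X\<close> whose points are constantly \<open>1\<close>
  on \<open>W\<close>.

  The set \<open>\<Sigma>\<close> is dense in the cube, sequentially compact and \<open>\<omega>\<close>-bounded, so \<open>Y\<close> is pseudocompact
  and inherits the compactness properties of \<open>X\<close>.  Every space between \<open>\<Sigma>\<close> and the cube is Ascoli:
  a failure of equicontinuity at a point \<open>p\<close> is witnessed along a sequence in \<open>\<Sigma>\<close> that converges to
  the restriction of \<open>p\<close> to a countable set of coordinates.  Finally the indicator of \<open>F\<close>
  is discontinuous as \<open>\<Sigma>\<close> is dense, but \<open>k\<close>-continuous: if a compact \<open>C \<subseteq> Y\<close> accumulated at \<open>F\<close> from
  within \<open>\<Sigma>\<close>, it would contain a point equal to \<open>1\<close> on exactly \<open>\<aleph>\<^sub>1\<close> elements of \<open>W\<close> and to \<open>0\<close> on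
  the others.\<close>

subsection \<open>\<open>\<Sigma>\<close>-products of intervals\<close>

text \<open>Points are total functions that vanish off \<open>J\<close>, so that cubes over
  different index sets lie in one function space, are nested like their index sets and inherit its
  product topology.\<close>

definition cube_on :: "'i set \<Rightarrow> ('i \<Rightarrow> real) set" where
  "cube_on J = {y. (\<forall>i. y i \<in> {0..1}) \<and> (\<forall>i. i \<notin> J \<longrightarrow> y i = 0)}"

definition sigma_cube :: "'i set \<Rightarrow> ('i \<Rightarrow> real) set" where
  "sigma_cube J = {y \<in> cube_on J. countable {i. y i \<noteq> 0}}"

lemma sigma_cube_subset: "sigma_cube J \<subseteq> cube_on J"
  by (auto simp: sigma_cube_def)

lemma cube_on_mono: "A \<subseteq> B \<Longrightarrow> cube_on A \<subseteq> cube_on B"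
  by (auto simp: cube_on_def)

lemma cube_on_countable_subset: "countable A \<Longrightarrow> A \<subseteq> J \<Longrightarrow> cube_on A \<subseteq> sigma_cube J"
  by (auto simp: cube_on_def sigma_cube_def intro: countable_subset)

lemma sigma_cube_in_cube_on: "y \<in> sigma_cube J \<Longrightarrow> y \<in> cube_on {i. y i \<noteq> 0}"
  by (auto simp: cube_on_def sigma_cube_def)

lemma openin_coordinate_box:
  fixes p :: "'i \<Rightarrow> real"
  assumes "finite A"
  shows "openin (top_of_set S) {z \<in> S. \<forall>i\<in>A. \<bar>z i - p i\<bar> < e}"
proof -
  have "open {z :: 'i \<Rightarrow> real. \<forall>i\<in>A. z i \<in> ball (p i) e}"
    using product_topology_basis'[of A "\<lambda>i. ball (p i) e" id] assms by simp
  moreover have "{z \<in> S. \<forall>i\<in>A. \<bar>z i - p i\<bar> < e} = S \<inter> {z. \<forall>i\<in>A. z i \<in> ball (p i) e}"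
    by (auto simp: dist_real_def abs_minus_commute)
  ultimately show ?thesis
    by (auto simp: openin_open)
qed

text \<open>All points of \<open>S\<close> vanish off \<open>J\<close>, so a basic neighbourhood
  restricts them only at its finitely many coordinates in \<open>J\<close>; the minimum of the radii
  serves for all.\<close>

lemma openin_coordinate_boxE:
  fixes p :: "'i \<Rightarrow> real"
  assumes U: "openin (top_of_set S) U" "p \<in> U" and S: "S \<subseteq> cube_on J"
  obtains A e where "finite A" "A \<subseteq> J" "e > 0" "{z \<in> S. \<forall>i\<in>A. \<bar>z i - p i\<bar> < e} \<subseteq> U"
proof -
  obtain T where T: "open T" "U = S \<inter> T"
    using U by (auto simp: openin_open)
  have "openin (product_topology (\<lambda>i. euclidean) UNIV) T" "p \<in> T"
    using T U by (auto simp: euclidean_product_topology)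
  from product_topology_open_contains_basis[OF this]
  obtain X where X: "\<And>i. p i \<in> X i" "\<And>i. open (X i)" "finite {i. X i \<noteq> UNIV}" "Pi\<^sub>E UNIV X \<subseteq> T"
    by (auto simp: PiE_iff)
  define A where "A = {i. X i \<noteq> UNIV}"
  have "\<exists>e>0. ball (p i) e \<subseteq> X i" for i
    using X(1,2) open_contains_ball by blast
  then obtain d where d: "\<And>i. d i > 0" "\<And>i. ball (p i) (d i) \<subseteq> X i"
    by metis
  define e where "e = Min (insert 1 (d ` A))"
  have "finite A" using X(3) by (simp add: A_def)
  then have e: "e > 0" "\<And>i. i \<in> A \<Longrightarrow> e \<le> d i"
    using d(1) by (auto simp: e_def)
  have "p \<in> S" using U T by auto
  show thesis
  proof (rule that[of "A \<inter> J" e])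
    show "{z \<in> S. \<forall>i\<in>A \<inter> J. \<bar>z i - p i\<bar> < e} \<subseteq> U"
    proof
      fix z assume z: "z \<in> {z \<in> S. \<forall>i\<in>A \<inter> J. \<bar>z i - p i\<bar> < e}"
      have "z i \<in> X i" for i
      proof (cases "i \<in> A")
        case True
        have "\<bar>z i - p i\<bar> < e"
        proof (cases "i \<in> J")
          case False
          then have "z i = 0" "p i = 0"
            using z S \<open>p \<in> S\<close> by (auto simp: cube_on_def)
          then show ?thesis using e by simp
        qed (use True z in auto)
        then have "z i \<in> ball (p i) (d i)"
          using e(2)[OF True] by (auto simp: dist_real_def)
        then show ?thesis using d by blast
      qed (auto simp: A_def)
      then show "z \<in> U" using X(4) z T by auto
    qed
  qed (use \<open>finite A\<close> e in auto)
qed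

lemma limitin_coordinatewise:
  fixes x :: "nat \<Rightarrow> 'i \<Rightarrow> real"
  assumes "\<And>n. x n \<in> S" "l \<in> S" "\<And>i. (\<lambda>n. x n i) \<longlonglongrightarrow> l i"
  shows "limitin (top_of_set S) x l sequentially"
proof -
  have "limitin (product_topology (\<lambda>i. euclidean) UNIV) x l sequentially"
    using assms by (simp add: limitin_componentwise)
  then show ?thesis
    using assms by (simp add: limitin_subtopology euclidean_product_topology)
qed

text \<open>Tychonoff's theorem, with the factor \<open>{0}\<close> at coordinates off
  \<open>J\<close>.\<close>

lemma compact_cube_on: "compact (cube_on J)"
proof -
  have "compactin (product_topology (\<lambda>i. euclidean) UNIV) (\<Pi>\<^sub>E i\<in>UNIV. if i \<in> J then {0..1::real} else {0})"
    by (subst compactin_PiE) auto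
  moreover have "(\<Pi>\<^sub>E i\<in>UNIV. if i \<in> J then {0..1::real} else {0}) = cube_on J"
    by (force simp: cube_on_def PiE_iff split: if_splits)
  ultimately show ?thesis
    by (simp add: euclidean_product_topology)
qed

text \<open>Reindexing by an enumeration of \<open>A\<close> reduces to a product over \<open>nat\<close>,
  which is first countable.\<close>

lemma cube_on_convergent_subsequence:
  fixes x :: "nat \<Rightarrow> 'i \<Rightarrow> real"
  assumes "countable A" "\<And>n. x n \<in> cube_on A"
  obtains r l where "strict_mono r" "l \<in> cube_on A" "\<forall>i. (\<lambda>n. x (r n) i) \<longlonglongrightarrow> l i"
proof -
  define u where "u n k = x n (from_nat_into A k)" for n k
  have u: "u n \<in> cube_on UNIV" for n
    using assms(2)[of n] by (auto simp: u_def cube_on_def)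
  have "seq_compact (cube_on UNIV :: (nat \<Rightarrow> real) set)"
    by (rule compact_imp_seq_compact[OF compact_cube_on])
  then obtain v r where v: "v \<in> cube_on UNIV" "strict_mono r" "(u \<circ> r) \<longlonglongrightarrow> v"
    using u unfolding seq_compact_def by metis
  from v(3) have vk: "(\<lambda>n. u (r n) k) \<longlonglongrightarrow> v k" for k
    using limitin_componentwise[of "\<lambda>_. euclidean" UNIV "u \<circ> r" v sequentially]
    by (simp add: euclidean_product_topology)
  define l where "l i = (if i \<in> A then v (to_nat_on A i) else 0)" for i
  show thesis
  proof (rule that[of r l])
    show "l \<in> cube_on A"
      using v(1) by (auto simp: l_def cube_on_def)
    have "(\<lambda>n. x (r n) i) \<longlonglongrightarrow> l i" for i
    proof (cases "i \<in> A")
      case True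
      then show ?thesis
        using vk[of "to_nat_on A i"] assms(1) by (simp add: u_def l_def)
    next
      case False
      then show ?thesis
        using assms(2) by (simp add: l_def cube_on_def)
    qed
    then show "\<forall>i. (\<lambda>n. x (r n) i) \<longlonglongrightarrow> l i" ..
  qed (use v in auto)
qed

text \<open>A countable union of countable supports is countable. Hence questions about one sequence
  in \<Sigma> reduce to a cube with countably many coordinates, which is compact and sequentially
  compact.\<close>

lemma sigma_cube_support_UN:
  fixes x :: "nat \<Rightarrow> 'i \<Rightarrow> real"
  assumes "\<And>n. x n \<in> sigma_cube J"
  obtains A where "countable A" "A \<subseteq> J" "\<forall>n. x n \<in> cube_on A"
proof (rule that[of "\<Union>n. {i. x n i \<noteq> 0}"])
  show "countable (\<Union>n. {i. x n i \<noteq> 0})" "(\<Union>n. {i. x n i \<noteq> 0}) \<subseteq> J"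
    using assms by (auto simp: sigma_cube_def cube_on_def)
  have "x n \<in> cube_on (\<Union>n. {i. x n i \<noteq> 0})" for n
    using sigma_cube_in_cube_on[OF assms, of n]
    by (rule subsetD[OF cube_on_mono, rotated]) blast
  then show "\<forall>n. x n \<in> cube_on (\<Union>n. {i. x n i \<noteq> 0})" ..
qed

lemma sigma_cube_convergent_subsequence:
  fixes x :: "nat \<Rightarrow> 'i \<Rightarrow> real"
  assumes "\<And>n. x n \<in> sigma_cube J"
  obtains r l where "strict_mono r" "l \<in> sigma_cube J" "\<forall>i. (\<lambda>n. x (r n) i) \<longlonglongrightarrow> l i"
proof -
  obtain A where A: "countable A" "A \<subseteq> J" "\<forall>n. x n \<in> cube_on A"
    using sigma_cube_support_UN[of x J, OF assms] .
  then obtain r l where "strict_mono r" "l \<in> cube_on A" "\<forall>i. (\<lambda>n. x (r n) i) \<longlonglongrightarrow> l i"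
    using cube_on_convergent_subsequence[of A x] by blast
  then show thesis
    using that A cube_on_countable_subset by blast
qed

text \<open>A point of \<open>U\<close>, truncated to the finitely many coordinates of a box inside
  \<open>U\<close>, has finite support and stays in the box.\<close>

lemma sigma_cube_dense:
  fixes p :: "'i \<Rightarrow> real"
  assumes S: "sigma_cube J \<subseteq> S" "S \<subseteq> cube_on J" and U: "openin (top_of_set S) U" "U \<noteq> {}"
  shows "U \<inter> sigma_cube J \<noteq> {}"
proof -
  obtain p where "p \<in> U" using U by auto
  then obtain A e where A: "finite A" "A \<subseteq> J" "e > 0" "{z \<in> S. \<forall>i\<in>A. \<bar>z i - p i\<bar> < e} \<subseteq> U"
    using openin_coordinate_boxE[OF U(1) _ S(2)] by blast
  have p: "p \<in> cube_on J"
    using \<open>p \<in> U\<close> openin_imp_subset[OF U(1)] S by auto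
  define q where "q i = (if i \<in> A then p i else 0)" for i
  have "q \<in> cube_on A"
    using p by (auto simp: q_def cube_on_def)
  then have q: "q \<in> sigma_cube J"
    using cube_on_countable_subset A(1,2) by (meson countable_finite subsetD)
  moreover have "q \<in> U"
    using A q S(1) by (auto simp: q_def)
  ultimately show ?thesis by blast
qed

lemma tychonoff_top_of_set:
  fixes S :: "('i \<Rightarrow> real) set"
  shows "tychonoff_space (top_of_set S)"
proof -
  have "completely_regular_space (euclidean :: ('i \<Rightarrow> real) topology)"
    by (subst euclidean_product_topology[symmetric])
       (simp add: completely_regular_space_product_topology
          metrizable_imp_completely_regular_space metrizable_space_euclidean)
  moreover have "Hausdorff_space (euclidean :: ('i \<Rightarrow> real) topology)"
    by (subst euclidean_product_topology[symmetric]) (simp add: Hausdorff_space_product_topology)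
  ultimately show ?thesis
    by (simp add: tychonoff_space_def completely_regular_space_subtopology Hausdorff_space_subtopology)
qed

section \<open>Near sequential compactness and pseudocompactness\<close>

lemma near_sequentially_compact_between:
  fixes S :: "('i \<Rightarrow> real) set"
  assumes S: "sigma_cube J \<subseteq> S" "S \<subseteq> cube_on J"
  shows "near_sequentially_compact_space (top_of_set S)"
  unfolding near_sequentially_compact_space_def
proof (intro allI impI)
  fix U :: "nat \<Rightarrow> ('i \<Rightarrow> real) set"
  assume U: "\<forall>n. openin (top_of_set S) (U n) \<and> U n \<noteq> {}"
  \<comment> \<open>Density lets the points be chosen in \<Sigma>, where every sequence has a
    convergent subsequence.\<close>
  then have "\<forall>n. \<exists>x. x \<in> U n \<inter> sigma_cube J"
    using sigma_cube_dense[OF S] by fast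
  then obtain x where "\<forall>n. x n \<in> U n \<inter> sigma_cube J"
    by (rule choice[THEN exE])
  then have x: "\<And>n. x n \<in> U n" "\<And>n. x n \<in> sigma_cube J"
    by auto
  obtain r l where "strict_mono r" "l \<in> sigma_cube J" "\<forall>i. (\<lambda>n. x (r n) i) \<longlonglongrightarrow> l i"
    using sigma_cube_convergent_subsequence[of x J, OF x(2)] .
  then have "limitin (top_of_set S) (x \<circ> r) l sequentially"
    using x(2) S by (intro limitin_coordinatewise) auto
  then show "\<exists>x. (\<forall>n. x n \<in> U n) \<and>
      (\<exists>r l. strict_mono r \<and> limitin (top_of_set S) (x \<circ> r) l sequentially)"
    using x(1) \<open>strict_mono r\<close> by blast
qed

text \<open>An unbounded \<open>f\<close> makes all the open sets \<open>U n\<close>, on which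
  \<open>f\<close> exceeds \<open>n\<close> in absolute value, nonempty; but \<open>f\<close> is
  bounded along a convergent sequence.\<close>

lemma near_sequentially_compact_imp_pseudocompact:
  assumes "near_sequentially_compact_space Z"
  shows "pseudocompact_space Z"
  unfolding pseudocompact_space_def
proof (intro allI impI, rule ccontr)
  fix f assume f: "continuous_map Z euclideanreal f" and nb: "\<not> bounded (f ` topspace Z)"
  define U where "U n = {z \<in> topspace Z. f z \<in> - cball 0 (real n)}" for n
  have "openin Z (U n)" for n
    unfolding U_def by (rule openin_continuous_map_preimage[OF f]) auto
  moreover have "U n \<noteq> {}" for n
    using nb by (force simp: U_def bounded_iff not_le)
  ultimately obtain x r l where x: "\<And>n. x n \<in> U n" "strict_mono r" "limitin Z (x \<circ> r) l sequentially"
    using assms unfolding near_sequentially_compact_space_def by metis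
  then have "(\<lambda>n. f (x (r n))) \<longlonglongrightarrow> f l"
    using continuous_map_limit[OF f x(3)] by (simp add: o_def)
  then have "Bseq (\<lambda>n. f (x (r n)))"
    by (meson convergent_def convergent_imp_Bseq)
  then obtain K where K: "\<And>n. \<bar>f (x (r n))\<bar> \<le> K"
    by (auto simp: Bseq_def)
  obtain n :: nat where "real n > K" using reals_Archimedean2 by blast
  moreover have "\<bar>f (x (r n))\<bar> > real (r n)"
    using x(1)[of "r n"] by (auto simp: U_def)
  moreover have "real n \<le> real (r n)"
    using x(2) by (simp add: seq_suble)
  moreover note K[of n]
  ultimately show False by linarith
qed

subsection \<open>The Ascoli property\<close>

text \<open>If every point of \<open>K\<close> had a neighbourhood visited only finitely often, a
  finite subcover would leave only finitely many indices.\<close>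

lemma compactin_sequence_cluster_point:
  assumes K: "compactin T K" and x: "\<And>n. x n \<in> K"
  obtains l where "l \<in> K" "\<forall>U. openin T U \<and> l \<in> U \<longrightarrow> infinite {n::nat. x n \<in> U}"
proof (rule ccontr)
  assume "\<not> thesis"
  with that have "\<forall>l\<in>K. \<exists>U. openin T U \<and> l \<in> U \<and> finite {n. x n \<in> U}"
    by blast
  then obtain U where U: "\<forall>l\<in>K. openin T (U l) \<and> l \<in> U l \<and> finite {n. x n \<in> U l}"
    by (rule bchoice[THEN exE])
  have "\<exists>\<F>. finite \<F> \<and> \<F> \<subseteq> U ` K \<and> K \<subseteq> \<Union>\<F>"
    using U by (intro compactinD[OF K]) auto
  then obtain \<F> where F: "finite \<F>" "\<F> \<subseteq> U ` K" "K \<subseteq> \<Union>\<F>"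
    by blast
  have "(UNIV :: nat set) = (\<Union>V\<in>\<F>. {n. x n \<in> V})"
    using F(3) x by auto
  moreover have "finite (\<Union>V\<in>\<F>. {n. x n \<in> V})"
    using F(1,2) U by auto
  ultimately show False
    by (metis infinite_UNIV_nat)
qed

lemma openin_Ck:
  assumes "compactin Y K" "open U"
  shows "openin (Ck Y) {f \<in> Ck_carrier Y. f ` K \<subseteq> U}"
  unfolding Ck_def by (rule topology_generated_by_Basis) (use assms in blast)

text \<open>If equicontinuity fails at \<open>p\<close>, there are \<open>y n\<close> in the \<open>\<Sigma>\<close>-product and \<open>g n \<in> \<K>\<close>
  with \<open>g n (y n)\<close> far from \<open>g n p\<close>, and the \<open>y n\<close> can be made to approximate \<open>p\<close> on the
  countable set \<open>A\<close> of all coordinates relevant to some \<open>y n\<close>, or to the continuity of some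
  \<open>g n\<close> at \<open>p\<close>.  Then \<open>y n\<close> converges to the point \<open>q\<close> that agrees with \<open>p\<close> on \<open>A\<close> and
  vanishes elsewhere, and \<open>g n q\<close> is close to \<open>g n p\<close> for all \<open>n\<close>.  On the convergent
  sequence \<open>y\<close> the \<open>g n\<close> accumulate uniformly, a contradiction.\<close>

lemma compactin_Ck_equicontinuous:
  fixes S :: "('i \<Rightarrow> real) set"
  assumes S: "sigma_cube J \<subseteq> S" "S \<subseteq> cube_on J"
    and K: "compactin (Ck (top_of_set S)) \<K>" and p: "p \<in> S" and "\<delta> > 0"
  obtains N where "openin (top_of_set S) N" "p \<in> N" "\<forall>y\<in>N. \<forall>g\<in>\<K>. \<bar>g y - g p\<bar> \<le> \<delta>"
proof (rule ccontr)
  assume "\<not> thesis"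
  with that have bad: "\<exists>y\<in>N. \<exists>g\<in>\<K>. \<bar>g y - g p\<bar> > \<delta>" if "openin (top_of_set S) N" "p \<in> N" for N
    using \<open>openin (top_of_set S) N\<close> \<open>p \<in> N\<close> by (meson not_le)
  have cont: "continuous_map (top_of_set S) euclideanreal g" if "g \<in> \<K>" for g
    using that compactin_subset_topspace[OF K] by (auto simp: topspace_Ck Ck_carrier_def)
  \<comment> \<open>The inequality is an open condition on \<open>y\<close>, so density moves the
    witness into \<Sigma>.\<close>
  have bad_sigma: "\<exists>y\<in>N \<inter> sigma_cube J. \<exists>g\<in>\<K>. \<bar>g y - g p\<bar> > \<delta>"
    if N: "openin (top_of_set S) N" "p \<in> N" for N
  proof -
    obtain y g where yg: "y \<in> N" "g \<in> \<K>" "\<bar>g y - g p\<bar> > \<delta>"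
      using bad[OF N] by blast
    define V where "V = {z \<in> topspace (top_of_set S). g z \<in> {t. \<bar>t - g p\<bar> > \<delta>}}"
    have "open {t. \<bar>t - g p\<bar> > \<delta>}"
      by (intro open_Collect_less continuous_intros)
    then have "openin (top_of_set S) V"
      unfolding V_def by (intro openin_continuous_map_preimage[OF cont[OF yg(2)]]) simp
    then have "openin (top_of_set S) (N \<inter> V)"
      using N by blast
    moreover have "y \<in> N \<inter> V"
      using yg N openin_imp_subset[OF N(1)] by (auto simp: V_def)
    ultimately have "N \<inter> V \<inter> sigma_cube J \<noteq> {}"
      using sigma_cube_dense[OF S] by blast
    then show ?thesis
      using yg(2) by (auto simp: V_def)
  qed
  \<comment> \<open>Up to \<delta>/4, continuity of \<open>g\<close> at \<open>p\<close> depends on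
    finitely many coordinates. The point \<open>q\<close> below agrees with \<open>p\<close> exactly
    on them, so the radius of the box can be forgotten.\<close>
  have "\<exists>F. finite F \<and> (\<forall>z\<in>S. (\<forall>i\<in>F. z i = p i) \<longrightarrow> \<bar>g z - g p\<bar> < \<delta>/4)"
    if "g \<in> \<K>" for g
  proof -
    define V where "V = {z \<in> topspace (top_of_set S). g z \<in> {t. \<bar>t - g p\<bar> < \<delta>/4}}"
    have "open {t. \<bar>t - g p\<bar> < \<delta>/4}"
      by (intro open_Collect_less continuous_intros)
    then have V: "openin (top_of_set S) V"
      unfolding V_def by (intro openin_continuous_map_preimage[OF cont[OF that]]) simp
    have "p \<in> V"
      using p \<open>\<delta> > 0\<close> by (simp add: V_def)
    obtain F e where "finite F" "F \<subseteq> J" "e > 0" "{z \<in> S. \<forall>i\<in>F. \<bar>z i - p i\<bar> < e} \<subseteq> V"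
      using openin_coordinate_boxE[OF V \<open>p \<in> V\<close> S(2)] .
    then show ?thesis
      by (intro exI[of _ F]) (auto simp: V_def)
  qed
  then have "\<forall>g\<in>\<K>. \<exists>F. finite F \<and> (\<forall>z\<in>S. (\<forall>i\<in>F. z i = p i) \<longrightarrow> \<bar>g z - g p\<bar> < \<delta>/4)" ..
  then obtain F where
    "\<forall>g\<in>\<K>. finite (F g) \<and> (\<forall>z\<in>S. (\<forall>i\<in>F g. z i = p i) \<longrightarrow> \<bar>g z - g p\<bar> < \<delta>/4)"
    by (rule bchoice[THEN exE])
  then have F: "finite (F g)" "\<forall>z\<in>S. (\<forall>i\<in>F g. z i = p i) \<longrightarrow> \<bar>g z - g p\<bar> < \<delta>/4"
    if "g \<in> \<K>" for g
    using that by auto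
  \<comment> \<open>The coordinates that one stage \<open>(y, g)\<close> makes relevant: the support
    of \<open>y\<close> and those that control \<open>g\<close> near \<open>p\<close>.\<close>
  define E where "E yg = {i. fst yg i \<noteq> 0} \<union> F (snd yg)"
    for yg :: "('i \<Rightarrow> real) \<times> (('i \<Rightarrow> real) \<Rightarrow> real)"
  \<comment> \<open>Stage \<open>n\<close> must respect the first \<open>n\<close> coordinates of
    each of the first \<open>n\<close> sets \<open>E (h m)\<close>, so that every coordinate in
    their union is respected from some stage on.\<close>
  define P where "P h n yg \<longleftrightarrow> fst yg \<in> sigma_cube J \<and> snd yg \<in> \<K> \<and>
      \<bar>snd yg (fst yg) - snd yg p\<bar> > \<delta> \<and>
      (\<forall>m<n. \<forall>k<n. \<bar>fst yg (from_nat_into (E (h m)) k) - p (from_nat_into (E (h m)) k)\<bar> < 1 / real (Suc n))"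
    for h and n :: nat and yg :: "('i \<Rightarrow> real) \<times> (('i \<Rightarrow> real) \<Rightarrow> real)"
  have "\<exists>h. \<forall>n. P h n (h n)"
  \<comment> \<open>\<open>P h n\<close> looks at \<open>h\<close> only below \<open>n\<close>,
    which permits choosing the stages by recursion.\<close>
  proof (rule dependent_wellorder_choice)
    show "\<exists>yg. P h n yg" for h n
    proof -
      let ?B = "(\<lambda>(m, k). from_nat_into (E (h m)) k) ` ({..<n} \<times> {..<n})"
      let ?N = "{z \<in> S. \<forall>i\<in>?B. \<bar>z i - p i\<bar> < 1 / real (Suc n)}"
      have "openin (top_of_set S) ?N"
        by (rule openin_coordinate_box) simp
      moreover have "p \<in> ?N" using p by simp
      ultimately obtain y g where yg: "y \<in> ?N \<inter> sigma_cube J" "g \<in> \<K>" "\<bar>g y - g p\<bar> > \<delta>"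
        using bad_sigma by meson
      then have "P h n (y, g)"
        by (auto simp: P_def)
      then show ?thesis ..
    qed
  qed (simp add: P_def)
  then obtain h where h: "\<And>n. P h n (h n)" by blast
  define y where "y n = fst (h n)" for n
  define g where "g n = snd (h n)" for n
  define A where "A = (\<Union>n. E (h n))"
  define q where "q i = (if i \<in> A then p i else 0)" for i
  have y: "y n \<in> sigma_cube J" and g: "g n \<in> \<K>" and far: "\<bar>g n (y n) - g n p\<bar> > \<delta>" for n
    using h[of n] by (auto simp: P_def y_def g_def)
  have close: "\<bar>y n (from_nat_into (E (h m)) k) - p (from_nat_into (E (h m)) k)\<bar> < 1 / real (Suc n)"
    if "m < n" "k < n" for m n k
    using h[of n] that by (auto simp: P_def y_def)
  have countE: "countable (E (h n))" for n
    using y[of n] F(1)[OF g[of n]] by (auto simp: E_def y_def g_def sigma_cube_def intro: countable_finite)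
  then have "countable A" by (simp add: A_def)
  moreover have "p \<in> cube_on J" using p S by blast
  ultimately have q: "q \<in> sigma_cube J"
    by (auto simp: sigma_cube_def cube_on_def q_def elim: countable_subset[rotated])
  have lim: "(\<lambda>n. y n i) \<longlonglongrightarrow> q i" for i
  proof (cases "i \<in> A")
    case True
    then obtain m where "i \<in> E (h m)" by (auto simp: A_def)
    then obtain k where k: "from_nat_into (E (h m)) k = i"
      using from_nat_into_surj countE by metis
    have "\<forall>\<^sub>F n in sequentially. norm (y n i - p i) \<le> 1 / real (Suc n)"
      using eventually_gt_at_top[of m] eventually_gt_at_top[of k]
    proof eventually_elim
      case (elim n)
      then show ?case using close[of m n k] k by simp
    qed
    moreover have "(\<lambda>n. 1 / real (Suc n)) \<longlonglongrightarrow> 0"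
      using LIMSEQ_inverse_real_of_nat by (simp add: inverse_eq_divide)
    ultimately have "(\<lambda>n. y n i - p i) \<longlonglongrightarrow> 0"
      by (rule Lim_null_comparison)
    then show ?thesis
      using True by (simp add: q_def LIM_zero_iff)
  next
    case False
    then have "y n i = 0" for n
      by (auto simp: A_def E_def y_def)
    with False show ?thesis by (simp add: q_def)
  qed
  have yq: "limitin (top_of_set S) y q sequentially"
    using y q S by (intro limitin_coordinatewise lim) auto
  have gq: "\<bar>g n q - g n p\<bar> < \<delta>/4" for n
  proof -
    have "\<forall>i\<in>F (g n). q i = p i"
      by (auto simp: q_def A_def E_def g_def)
    then show ?thesis using F(2)[OF g] q S by blast
  qed
  obtain \<gamma> where \<gamma>: "\<gamma> \<in> \<K>" "\<forall>U. openin (Ck (top_of_set S)) U \<and> \<gamma> \<in> U \<longrightarrow> infinite {n. g n \<in> U}"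
    using compactin_sequence_cluster_point[of _ _ g, OF K g] .
  have "(\<lambda>n. \<gamma> (y n)) \<longlonglongrightarrow> \<gamma> q"
    using continuous_map_limit[OF cont[OF \<gamma>(1)] yq] by (simp add: o_def)
  then obtain n0 where n0: "\<And>n. n \<ge> n0 \<Longrightarrow> dist (\<gamma> (y n)) (\<gamma> q) < \<delta>/4"
    using \<open>\<delta> > 0\<close> by (metis lim_sequentially zero_less_divide_iff zero_less_numeral)
  \<comment> \<open>Starting at \<open>n0\<close> keeps \<open>\<gamma>\<close> within \<delta>/4 of
    \<open>\<gamma> q\<close> on all of \<open>C\<close>, so that \<open>\<gamma>\<close> belongs to
    the open set \<open>U\<close> below.\<close>
  define C where "C = insert q (y ` {n0..})"
  have C: "compactin (top_of_set S) C"
    unfolding C_def using y S by (intro compactin_sequence_with_limit[OF yq]) auto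
  define U where "U = {f \<in> Ck_carrier (top_of_set S). f ` C \<subseteq> ball (\<gamma> q) (\<delta>/4)}"
  have "openin (Ck (top_of_set S)) U"
    unfolding U_def by (rule openin_Ck[OF C]) simp
  moreover have "\<gamma> \<in> U"
    using n0 \<gamma>(1) compactin_subset_topspace[OF K] \<open>\<delta> > 0\<close>
    by (auto simp: U_def C_def topspace_Ck dist_commute)
  ultimately have "infinite {n. g n \<in> U}"
    using \<gamma>(2) by blast
  then obtain n where n: "n \<ge> n0" "g n \<in> U"
    unfolding infinite_nat_iff_unbounded_le by auto
  \<comment> \<open>Three errors below \<delta>/4 separate \<open>g n (y n)\<close> from
    \<open>g n p\<close>, by way of \<open>\<gamma> q\<close> and \<open>g n q\<close>.\<close>
  then have "\<bar>\<gamma> q - g n (y n)\<bar> < \<delta>/4" "\<bar>\<gamma> q - g n q\<bar> < \<delta>/4"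
    by (auto simp: U_def C_def image_subset_iff dist_real_def)
  with gq[of n] have "\<bar>g n (y n) - g n p\<bar> < \<delta>"
    unfolding abs_less_iff by argo
  with far[of n] show False by simp
qed

text \<open>Equicontinuity of \<K> at \<open>p\<close> bounds \<open>g y - g p\<close>, and the
  subbasic open set given by the compact set \<open>{p}\<close> bounds
  \<open>f p - g p\<close>.\<close>

lemma ascoli_between:
  fixes S :: "('i \<Rightarrow> real) set"
  assumes S: "sigma_cube J \<subseteq> S" "S \<subseteq> cube_on J"
  shows "ascoli_space (top_of_set S)"
  unfolding ascoli_space_def
proof (intro allI impI)
  fix \<K> assume K: "compactin (Ck (top_of_set S)) \<K>"
  let ?T = "prod_topology (top_of_set S) (subtopology (Ck (top_of_set S)) \<K>)"
  have "\<exists>U. openin ?T U \<and> z \<in> U \<and> (\<forall>w\<in>U. (case w of (y, f) \<Rightarrow> f y) \<in> ball (case z of (y, f) \<Rightarrow> f y) \<epsilon>)"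
    if z: "z \<in> topspace ?T" and "\<epsilon> > 0" for z \<epsilon>
  proof -
    obtain p f where zpf: "z = (p, f)" and p: "p \<in> S" and f: "f \<in> \<K>" "f \<in> Ck_carrier (top_of_set S)"
      using z by (auto simp: topspace_Ck)
    obtain N where N: "openin (top_of_set S) N" "p \<in> N" "\<forall>y\<in>N. \<forall>g\<in>\<K>. \<bar>g y - g p\<bar> \<le> \<epsilon>/3"
      using compactin_Ck_equicontinuous[OF S K p, of "\<epsilon>/3"] \<open>\<epsilon> > 0\<close> by auto
    define W where "W = {g \<in> Ck_carrier (top_of_set S). g ` {p} \<subseteq> ball (f p) (\<epsilon>/3)}"
    have "openin (Ck (top_of_set S)) W"
      unfolding W_def by (rule openin_Ck) (use p in auto)
    then have "openin ?T (N \<times> (W \<inter> \<K>))"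
      using N(1) by (auto simp: openin_prod_Times_iff openin_subtopology_Int)
    moreover have "z \<in> N \<times> (W \<inter> \<K>)"
      using N f \<open>\<epsilon> > 0\<close> by (simp add: zpf W_def)
    moreover have "(case w of (y, f) \<Rightarrow> f y) \<in> ball (case z of (y, f) \<Rightarrow> f y) \<epsilon>" if "w \<in> N \<times> (W \<inter> \<K>)" for w
    proof -
      obtain y g where w: "w = (y, g)" "y \<in> N" "g \<in> W" "g \<in> \<K>"
        using \<open>w \<in> N \<times> (W \<inter> \<K>)\<close> by blast
      then have "\<bar>g y - g p\<bar> \<le> \<epsilon>/3" "\<bar>f p - g p\<bar> < \<epsilon>/3"
        using N(3) by (auto simp: W_def dist_real_def)
      then have "\<bar>f p - g y\<bar> < \<epsilon>" using \<open>\<epsilon> > 0\<close> by linarith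
      then show ?thesis by (simp add: w zpf dist_real_def)
    qed
    ultimately show ?thesis by blast
  qed
  then show "continuous_map ?T euclideanreal (\<lambda>(y, f). f y)"
    using Met_TC.continuous_map_to_metric[of ?T "\<lambda>(y, f). f y"]
    unfolding mtopology_is_euclidean mball_eq_ball by blast
qed

subsection \<open>Compact sets and the failure of the \<open>k\<^sub>\<real>\<close> property\<close>

lemma card_of_fixed_length_lists_infinite:
  assumes "infinite B"
  shows "|{xs. set xs \<subseteq> B \<and> length xs = n}| \<le>o |B|"
proof (induction n)
  case 0
  have "{xs. set xs \<subseteq> B \<and> length xs = 0} = {[]}" by auto
  then show ?case
    using assms by (metis card_of_singl_ordLeq infinite_imp_nonempty)
next
  case (Suc n)
  let ?L = "\<lambda>n. {xs. set xs \<subseteq> B \<and> length xs = n}"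
  have cons: "?L (Suc n) = (\<lambda>(x, xs). x # xs) ` (B \<times> ?L n)"
    by (auto simp: length_Suc_conv)
  have "|?L (Suc n)| \<le>o |B \<times> ?L n|"
    unfolding cons by (rule card_of_image)
  moreover have "|B \<times> ?L n| \<le>o |B|"
    using card_of_Sigma_ordLeq_infinite[OF assms, of B "\<lambda>_. ?L n"] Suc
    by (simp add: card_of_refl ordIso_imp_ordLeq)
  ultimately show ?case
    by (rule ordLeq_transitive)
qed

lemma card_of_lists_infinite:
  assumes "infinite B"
  shows "|lists B| \<le>o |B|"
proof -
  have "lists B = (\<Union>n. {xs. set xs \<subseteq> B \<and> length xs = n})"
    by (auto simp: lists_eq_set)
  moreover have "|UNIV :: nat set| \<le>o |B|"
    using assms infinite_iff_card_of_nat by blast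
  ultimately show ?thesis
    using card_of_fixed_length_lists_infinite[OF assms]
    by (simp only:) (intro card_of_UNION_ordLeq_infinite[OF assms] ballI)
qed

text \<open>Add the values at all finite subsets and repeat \<omega> times. Each stage adds at most
  \<open>|B0|\<close> countable sets, since lists over an infinite set are no more numerous than its
  elements, and a finite subset of the union already lies in one stage.\<close>

lemma closure_under_finitary_map:
  fixes f :: "'i set \<Rightarrow> nat \<Rightarrow> 'i set"
  assumes B0: "infinite B0" "B0 \<subseteq> W"
    and f: "\<And>A n. finite A \<Longrightarrow> A \<subseteq> W \<Longrightarrow> countable (f A n) \<and> f A n \<subseteq> W"
  obtains B where "B0 \<subseteq> B" "B \<subseteq> W" "|B| \<le>o |B0|"
    "\<forall>A n. finite A \<and> A \<subseteq> B \<longrightarrow> f A n \<subseteq> B"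
proof -
  define step where "step B = B \<union> (\<Union>xs\<in>lists B. \<Union>n. f (set xs) n)" for B
  define Bs where "Bs k = (step ^^ k) B0" for k
  have Suc: "Bs (Suc k) = step (Bs k)" for k
    by (simp add: Bs_def)
  have mono: "Bs k \<subseteq> Bs (Suc k)" for k
    by (auto simp: Suc step_def)
  have "B0 \<subseteq> Bs k \<and> Bs k \<subseteq> W \<and> |Bs k| \<le>o |B0|" for k
  proof (induction k)
    case 0
    then show ?case using B0 by (simp add: Bs_def card_of_refl ordIso_imp_ordLeq)
  next
    case (Suc k)
    let ?C = "\<Union>xs\<in>lists (Bs k). \<Union>n. f (set xs) n"
    have inf: "infinite (Bs k)"
      using Suc B0 infinite_super by blast
    have small: "|\<Union>n. f (set xs) n| \<le>o |Bs k|" if "xs \<in> lists (Bs k)" for xs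
    proof -
      have "countable (\<Union>n. f (set xs) n)"
        using f[of "set xs"] that Suc by (auto simp: lists_eq_set)
      then show ?thesis
        using inf by (meson countable_card_le_natLeq infinite_iff_natLeq_ordLeq ordLeq_transitive)
    qed
    have "|?C| \<le>o |Bs k|"
      using card_of_lists_infinite[OF inf] small
      by (intro card_of_UNION_ordLeq_infinite[OF inf]) auto
    then have "|Bs (Suc k)| \<le>o |Bs k|"
      unfolding \<open>Bs (Suc k) = step (Bs k)\<close> step_def
      using inf by (intro card_of_Un_ordLeq_infinite_Field)
        (simp_all add: card_of_refl ordIso_imp_ordLeq Field_card_of card_of_card_order_on)
    moreover have "|Bs k| \<le>o |B0|"
      using Suc by blast
    ultimately have small_step: "|Bs (Suc k)| \<le>o |B0|"
      by (rule ordLeq_transitive)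
    have "f (set xs) n \<subseteq> W" if "xs \<in> lists (Bs k)" for xs n
      using f[of "set xs" n] that Suc by (auto simp: lists_eq_set)
    then have "?C \<subseteq> W" by blast
    then have "Bs (Suc k) \<subseteq> W"
      using Suc unfolding \<open>Bs (Suc k) = step (Bs k)\<close> step_def by blast
    then show ?case
      using Suc mono[of k] small_step by blast
  qed
  then have Bs: "B0 \<subseteq> Bs k" "Bs k \<subseteq> W" "|Bs k| \<le>o |B0|" for k
    by auto
  show thesis
  proof (rule that[of "\<Union>k. Bs k"])
    show "|\<Union>k. Bs k| \<le>o |B0|"
      using Bs(3) B0 infinite_iff_card_of_nat by (intro card_of_UNION_ordLeq_infinite) auto
    show "\<forall>A n. finite A \<and> A \<subseteq> (\<Union>k. Bs k) \<longrightarrow> f A n \<subseteq> (\<Union>k. Bs k)"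
    proof (intro allI impI)
      fix A n assume A: "finite A \<and> A \<subseteq> (\<Union>k. Bs k)"
      have "finite A" "A \<subseteq> (\<Union>k. Bs k)" using A by auto
      then have "\<exists>k. A \<subseteq> Bs k"
      proof (induction A)
        case (insert a A)
        then obtain k l where "A \<subseteq> Bs k" "a \<in> Bs l" by auto
        then have "insert a A \<subseteq> Bs (max k l)"
          using lift_Suc_mono_le[of Bs, OF mono, of k "max k l"]
            lift_Suc_mono_le[of Bs, OF mono, of l "max k l"] by auto
        then show ?case ..
      qed simp
      then obtain k where "A \<subseteq> Bs k" ..
      moreover obtain xs where "set xs = A"
        using A finite_list by blast
      ultimately have "f A n \<subseteq> Bs (Suc k)"
        unfolding Suc step_def by (auto simp: lists_eq_set)
      then show "f A n \<subseteq> (\<Union>k. Bs k)" by blast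
    qed
  qed (use Bs in blast)+
qed

text \<open>If no such box exists, compactness yields a point of \<open>C\<close> whose restriction to \<open>W\<close> is the indicator of
  a set of cardinality \<open>\<aleph>\<^sub>1\<close>: it is not in the \<open>\<Sigma>\<close>-product since \<open>\<aleph>\<^sub>1\<close> is uncountable, and not
  in \<open>F\<close> since \<open>\<aleph>\<^sub>1 < \<aleph>\<^sub>2\<close>.\<close>

lemma compact_separates_sigma_cube:
  fixes C F :: "('i \<Rightarrow> real) set"
  assumes C: "compact C" "C \<subseteq> sigma_cube J \<union> F"
    and F: "\<forall>y\<in>F. \<forall>w\<in>W. y w = 1" and W: "|W| =o aleph_2"
    and p: "p \<in> F" "p \<in> C"
  shows "\<exists>A e. finite A \<and> e > 0 \<and> (\<forall>z\<in>C. (\<forall>i\<in>A. \<bar>z i - p i\<bar> < e) \<longrightarrow> z \<in> F)"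
proof (rule ccontr)
  assume contra: "\<not> ?thesis"
  \<comment> \<open>Since \<open>p\<close> is 1 on \<open>W\<close>, failure of the claim yields
    points of \<open>C - F\<close>, hence of \<Sigma>, that are arbitrarily close to 1 on any finite
    subset of \<open>W\<close>.\<close>
  have "\<exists>z. z \<in> C - F \<and> (\<forall>i\<in>A. \<bar>z i - 1\<bar> < 1 / real (Suc n))" if A: "finite A" "A \<subseteq> W" for A n
  proof -
    have "1 / real (Suc n) > 0" by simp
    with contra A(1) obtain z where z: "z \<in> C - F" "\<forall>i\<in>A. \<bar>z i - p i\<bar> < 1 / real (Suc n)"
      by (meson DiffI)
    then have "\<forall>i\<in>A. \<bar>z i - 1\<bar> < 1 / real (Suc n)"
      using F p(1) A(2) by (metis subsetD)
    with z(1) show ?thesis by blast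
  qed
  then have "\<forall>A n. \<exists>z. finite A \<and> A \<subseteq> W \<longrightarrow> z \<in> C - F \<and> (\<forall>i\<in>A. \<bar>z i - 1\<bar> < 1 / real (Suc n))"
    by blast
  then obtain x where
    "\<forall>A n. finite A \<and> A \<subseteq> W \<longrightarrow> x A n \<in> C - F \<and> (\<forall>i\<in>A. \<bar>x A n i - 1\<bar> < 1 / real (Suc n))"
    unfolding choice_iff by blast
  then have x: "x A n \<in> C - F" "\<forall>i\<in>A. \<bar>x A n i - 1\<bar> < 1 / real (Suc n)"
    if "finite A" "A \<subseteq> W" for A n
    using that by auto
  \<comment> \<open>\<open>cardSuc natLeq\<close> is \<open>\<aleph>\<^sub>1\<close>; a subset
    \<open>B0\<close> of \<open>W\<close> of this size is uncountable and still smaller than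
    \<open>W\<close>.\<close>
  have co: "Card_order (cardSuc natLeq)" "cardSuc natLeq <o aleph_2"
    unfolding aleph_2_def by (auto simp: cardSuc_Card_order cardSuc_greater natLeq_Card_order)
  have "|Field (cardSuc natLeq)| \<le>o |W|"
    using co W card_of_Field_ordIso
    by (meson ordIso_ordLeq_trans ordIso_symmetric ordLess_imp_ordLeq ordLeq_ordIso_trans)
  then obtain b where b: "inj_on b (Field (cardSuc natLeq))" "b ` Field (cardSuc natLeq) \<subseteq> W"
    unfolding card_of_ordLeq[symmetric] by blast
  define B0 where "B0 = b ` Field (cardSuc natLeq)"
  have "|Field (cardSuc natLeq)| =o |B0|"
    using b(1) by (intro card_of_ordIsoI) (simp add: B0_def bij_betw_def)
  then have B0: "B0 \<subseteq> W" "|B0| =o cardSuc natLeq"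
    using b(2) card_of_Field_ordIso[OF co(1)] ordIso_symmetric ordIso_transitive
    unfolding B0_def by blast+
  have "\<not> |B0| \<le>o natLeq"
    using B0(2) cardSuc_greater[OF natLeq_Card_order]
    by (meson not_ordLess_ordLeq ordIso_ordLeq_trans ordIso_symmetric)
  then have unc: "uncountable B0"
    using countable_card_le_natLeq by blast
  \<comment> \<open>The witnesses have countable support, so \<open>B0\<close> can be enlarged, at
    no cost in cardinality, to a set \<open>B\<close> such that every witness for a finite subset of
    \<open>B\<close> vanishes on \<open>W - B\<close>.\<close>
  obtain B where B: "B0 \<subseteq> B" "B \<subseteq> W" "|B| \<le>o |B0|"
    "\<forall>A n. finite A \<and> A \<subseteq> B \<longrightarrow> W \<inter> {i. x A n i \<noteq> 0} \<subseteq> B"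
  proof (rule closure_under_finitary_map[of B0 W "\<lambda>A n. W \<inter> {i. x A n i \<noteq> 0}"])
    show "infinite B0" using unc countable_finite by blast
    show "countable (W \<inter> {i. x A n i \<noteq> 0}) \<and> W \<inter> {i. x A n i \<noteq> 0} \<subseteq> W"
      if "finite A" "A \<subseteq> W" for A n
      using x(1)[OF that, of n] C(2) by (auto simp: sigma_cube_def)
  qed (use B0 in auto)
  have "B \<noteq> W"
  proof
    assume "B = W"
    then have "aleph_2 \<le>o cardSuc natLeq"
      using B(3) B0(2) W by (meson ordIso_symmetric ordIso_ordLeq_trans ordLeq_ordIso_trans)
    then show False
      using co(2) not_ordLess_ordLeq by blast
  qed
  then obtain w0 where w0: "w0 \<in> W" "w0 \<notin> B" using B by blast
  \<comment> \<open>Jointly, these closed conditions say that a point restricts on \<open>W\<close>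
    to the indicator of \<open>B\<close>.\<close>
  define Q where "Q = (\<lambda>(i, n). {z :: 'i \<Rightarrow> real. \<bar>z i - 1\<bar> \<le> 1 / real (Suc n) \<and> (\<forall>j\<in>W - B. z j = 0)})"
  have "C \<inter> \<Inter>(Q ` (B \<times> UNIV)) \<noteq> {}"
  proof (rule compact_imp_fip_image[OF C(1)])
    show "closed (Q t)" for t
    proof -
      have "closed {z :: 'i \<Rightarrow> real. \<bar>z i - 1\<bar> \<le> r}" for i r
        by (intro closed_Collect_le continuous_intros continuous_on_subset[OF continuous_on_product_coordinates]) auto
      moreover have "closed {z :: 'i \<Rightarrow> real. z j = 0}" for j
        by (intro closed_Collect_eq continuous_intros continuous_on_subset[OF continuous_on_product_coordinates]) auto
      then have "closed (\<Inter>j\<in>W - B. {z :: 'i \<Rightarrow> real. z j = 0})"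
        by blast
      moreover have "Q t = {z. \<bar>z (fst t) - 1\<bar> \<le> 1 / real (Suc (snd t))} \<inter> (\<Inter>j\<in>W - B. {z. z j = 0})"
        by (auto simp: Q_def split: prod.splits)
      ultimately show ?thesis by auto
    qed
    show "C \<inter> \<Inter>(Q ` I) \<noteq> {}" if I: "finite I" "I \<subseteq> B \<times> UNIV" for I
    proof -
      \<comment> \<open>Finitely many conditions mention a finite set \<open>A\<close> of
        coordinates and a largest \<open>n\<close>, and the single witness \<open>x A n\<close>
        meets them all. The inserted \<open>0\<close> covers an empty \<open>I\<close>.\<close>
      define A where "A = fst ` I"
      define n where "n = Max (insert 0 (snd ` I))"
      have A: "finite A" "A \<subseteq> B" using I by (auto simp: A_def)
      then have "A \<subseteq> W" using B by blast
      note x = x[OF A(1) \<open>A \<subseteq> W\<close>, of n]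
      have "x A n \<in> Q t" if t: "t \<in> I" for t
      proof -
        have "fst t \<in> A" "snd t \<le> n"
          using t I(1) by (auto simp: A_def n_def)
        then have "\<bar>x A n (fst t) - 1\<bar> < 1 / real (Suc n)" "1 / real (Suc n) \<le> 1 / real (Suc (snd t))"
          using x(2) by (auto simp: frac_le)
        moreover have "\<forall>j\<in>W - B. x A n j = 0"
          using B(4) A by blast
        ultimately show ?thesis
          by (cases t) (simp add: Q_def)
      qed
      then show ?thesis using x(1) by blast
    qed
  qed
  then obtain z where z: "z \<in> C" "\<forall>i\<in>B. \<forall>n. z \<in> Q (i, n)"
    by blast
  have one: "z i = 1" if "i \<in> B" for i
  proof (rule ccontr)
    assume "z i \<noteq> 1"
    then obtain n where "inverse (real (Suc n)) < \<bar>z i - 1\<bar>"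
      using reals_Archimedean[of "\<bar>z i - 1\<bar>"] by auto
    moreover have "z \<in> Q (i, n)"
      using z(2) that by blast
    ultimately show False
      by (simp add: Q_def inverse_eq_divide)
  qed
  \<comment> \<open>Vanishing on \<open>W - B\<close> is part of each \<open>Q (i, n)\<close>;
    extracting it takes some \<open>i \<in> B\<close>.\<close>
  have "B \<noteq> {}" using B(1) unc by auto
  then have "z w0 = 0"
    using z(2) w0 by (auto simp: Q_def)
  then have "z \<notin> F"
    using F w0 by force
  then have "countable {i. z i \<noteq> 0}"
    using z(1) C(2) by (auto simp: sigma_cube_def)
  moreover have "B0 \<subseteq> {i. z i \<noteq> 0}"
    using B(1) one by force
  ultimately show False
    using unc countable_subset by blast
qed

lemma continuous_map_clopen_indicator:
  assumes "openin X (topspace X \<inter> F)" "openin X (topspace X - F)"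
  shows "continuous_map X euclideanreal (\<lambda>y. if y \<in> F then 1 else 0)"
  unfolding continuous_map_def
proof (intro conjI allI impI)
  fix U :: "real set"
  have "{x \<in> topspace X. (if x \<in> F then 1 else 0) \<in> U} =
      (if 1 \<in> U then topspace X \<inter> F else {}) \<union> (if 0 \<in> U then topspace X - F else {})"
    by auto
  then show "openin X {x \<in> topspace X. (if x \<in> F then 1 else 0) \<in> U}"
    using assms by auto
qed auto

text \<open>A countable support cannot contain \<open>W\<close>. This keeps \<Sigma> disjoint from
  \<open>F\<close> and makes the equations \<open>y w = 1\<close> single out \<open>F\<close> in the
  union, so that \<open>F\<close> is closed there.\<close>

lemma sigma_cube_not_one_on_uncountable:
  assumes "y \<in> sigma_cube J" "uncountable W"
  shows "\<exists>w\<in>W. y w \<noteq> 1"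
proof (rule ccontr)
  assume "\<not> ?thesis"
  then have "W \<subseteq> {i. y i \<noteq> 0}" by force
  then show False
    using assms countable_subset by (auto simp: sigma_cube_def)
qed

lemma not_k_real_between:
  fixes F :: "('i \<Rightarrow> real) set"
  assumes F: "F \<noteq> {}" "F \<subseteq> cube_on J" "\<forall>y\<in>F. \<forall>w\<in>W. y w = 1"
    and W: "|W| =o aleph_2" "uncountable W"
  shows "\<not> k_real_space (top_of_set (sigma_cube J \<union> F))"
proof
  let ?S = "sigma_cube J \<union> F"
  let ?f = "\<lambda>y. if y \<in> F then 1 else 0 :: real"
  have S: "sigma_cube J \<subseteq> ?S" "?S \<subseteq> cube_on J"
    using F(2) sigma_cube_subset by blast+
  have F_iff: "y \<in> F \<longleftrightarrow> (\<forall>w\<in>W. y w = 1)" if "y \<in> ?S" for y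
    using that F(3) sigma_cube_not_one_on_uncountable[OF _ W(2)] by blast
  assume k: "k_real_space (top_of_set ?S)"
  have "k_continuous (top_of_set ?S) ?f"
    unfolding k_continuous_def
  proof (intro allI impI)
    fix C assume "compactin (top_of_set ?S) C"
    then have C: "compact C" "C \<subseteq> sigma_cube J \<union> F"
      by (auto simp: compactin_subtopology)
    have sub: "subtopology (top_of_set ?S) C = top_of_set C"
      using C(2) by (simp add: subtopology_subtopology Int_absorb1)
    have "openin (top_of_set C) (C \<inter> F)"
    proof (subst openin_subopen, intro ballI)
      fix p assume "p \<in> C \<inter> F"
      then obtain A e where A: "finite A" "e > 0" "\<forall>z\<in>C. (\<forall>i\<in>A. \<bar>z i - p i\<bar> < e) \<longrightarrow> z \<in> F"
        using compact_separates_sigma_cube[OF C F(3) W(1)] by blast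
      then show "\<exists>T. openin (top_of_set C) T \<and> p \<in> T \<and> T \<subseteq> C \<inter> F"
        using \<open>p \<in> C \<inter> F\<close>
        by (intro exI[of _ "{z \<in> C. \<forall>i\<in>A. \<bar>z i - p i\<bar> < e}"]) (auto intro!: openin_coordinate_box)
    qed
    moreover have "openin (top_of_set C) (C - F)"
    proof -
      have eq: "C - F = C \<inter> (\<Union>w\<in>W. {z. z w \<noteq> 1})"
        using C(2) F_iff by blast
      have "open {z :: 'i \<Rightarrow> real. z w \<noteq> 1}" for w
        by (intro open_Collect_neq continuous_on_product_coordinates continuous_on_const)
      then have "open (\<Union>w\<in>W. {z :: 'i \<Rightarrow> real. z w \<noteq> 1})"
        by (intro open_UN) simp
      then show ?thesis
        unfolding eq openin_open by blast
    qed
    ultimately show "continuous_map (subtopology (top_of_set ?S) C) euclideanreal ?f"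
      unfolding sub by (intro continuous_map_clopen_indicator) simp_all
  qed
  then have cont: "continuous_map (top_of_set ?S) euclideanreal ?f"
    using k by (simp add: k_real_space_def)
  \<comment> \<open>A continuous indicator would make \<open>F\<close> a nonempty open set that
    misses the dense \<Sigma>.\<close>
  define U where "U = {y \<in> topspace (top_of_set ?S). ?f y \<in> {0<..}}"
  have "openin (top_of_set ?S) U"
    unfolding U_def by (rule openin_continuous_map_preimage[OF cont]) simp
  moreover have "U = F" by (auto simp: U_def)
  ultimately have "F \<inter> sigma_cube J \<noteq> {}"
    using sigma_cube_dense[OF S] F(1) by blast
  then show False
    using F(3) sigma_cube_not_one_on_uncountable[OF _ W(2)] by blast
qed

section \<open>Bases and weight of subspaces of the cube\<close>

lemma is_base_rational_boxes:
  fixes S :: "('i \<Rightarrow> real) set"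
  assumes S: "S \<subseteq> cube_on J" and J: "infinite J"
  obtains \<B> where "is_base (top_of_set S) \<B>" "|\<B>| \<le>o |J|"
proof -
  \<comment> \<open>Boxes with rational centres and radii \<open>1 / real (Suc n)\<close> are coded
    by lists, so that counting boxes becomes counting lists; the infinite \<open>J\<close> absorbs
    the countable data.\<close>
  define box where "box xs = {z \<in> S. \<forall>(i, q, n)\<in>set xs. \<bar>z i - of_rat q\<bar> < 1 / real (Suc n)}"
    for xs :: "('i \<times> rat \<times> nat) list"
  let ?L = "lists (J \<times> (UNIV :: (rat \<times> nat) set))"
  have "is_base (top_of_set S) (box ` ?L)"
    unfolding is_base_def
  proof (intro conjI allI impI ballI)
    fix V assume "V \<in> box ` ?L"
    then obtain xs where "V = box xs" by blast
    then have V: "V = S \<inter> (\<Inter>t\<in>set xs. {z. \<bar>z (fst t) - of_rat (fst (snd t))\<bar> < 1 / real (Suc (snd (snd t)))})"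
      by (auto simp: box_def case_prod_beta)
    have "open {z :: 'i \<Rightarrow> real. \<bar>z i - q\<bar> < r}" for i q r
      by (intro open_Collect_less continuous_intros continuous_on_product_coordinates)
    then have "open (\<Inter>t\<in>set xs. {z :: 'i \<Rightarrow> real. \<bar>z (fst t) - of_rat (fst (snd t))\<bar> < 1 / real (Suc (snd (snd t)))})"
      by (intro open_INT) auto
    then show "openin (top_of_set S) V"
      unfolding V openin_open by blast
  next
    fix U p assume U: "openin (top_of_set S) U \<and> p \<in> U"
    then obtain A e where A: "finite A" "A \<subseteq> J" "e > 0" "{z \<in> S. \<forall>i\<in>A. \<bar>z i - p i\<bar> < e} \<subseteq> U"
      using openin_coordinate_boxE[of S U p J] S by blast
    obtain n where n: "1 / real (Suc n) < e/2"
      using reals_Archimedean[of "e/2"] A(3) by (auto simp: inverse_eq_divide)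
    have "\<exists>q. \<bar>p i - of_rat q\<bar> < 1 / real (Suc n)" for i
    proof -
      obtain q where "p i - 1 / real (Suc n) < of_rat q" "of_rat q < p i"
        using of_rat_dense[of "p i - 1 / real (Suc n)" "p i"] by auto
      then show ?thesis by (intro exI[of _ q]) simp
    qed
    then obtain q where q: "\<And>i. \<bar>p i - of_rat (q i)\<bar> < 1 / real (Suc n)"
      by metis
    obtain as where as: "set as = A" using A(1) finite_list by blast
    define xs where "xs = map (\<lambda>i. (i, q i, n)) as"
    have "p \<in> S" using U openin_imp_subset by blast
    then have "p \<in> box xs" using q by (auto simp: box_def xs_def)
    moreover have "box xs \<subseteq> U"
    proof
      fix z assume z: "z \<in> box xs"
      have "\<bar>z i - p i\<bar> < e" if "i \<in> A" for i
      proof -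
        have "\<bar>z i - of_rat (q i)\<bar> < 1 / real (Suc n)"
          using z that by (auto simp: box_def xs_def as)
        with q[of i] n show ?thesis by linarith
      qed
      then show "z \<in> U" using A(4) z by (auto simp: box_def)
    qed
    moreover have "xs \<in> ?L" using A(2) as by (auto simp: xs_def)
    ultimately show "\<exists>V\<in>box ` ?L. p \<in> V \<and> V \<subseteq> U" by blast
  qed
  moreover have "|box ` ?L| \<le>o |J|"
  proof -
    have "|UNIV :: (rat \<times> nat) set| \<le>o |J|"
      using J countableI_type[of "UNIV :: (rat \<times> nat) set"]
      by (meson countable_card_of_nat infinite_iff_card_of_nat ordLeq_transitive)
    then have "|J \<times> (UNIV :: (rat \<times> nat) set)| =o |J|"
      using J by (intro card_of_Times_infinite_simps(1)) simp_all
    moreover have "infinite (J \<times> (UNIV :: (rat \<times> nat) set))"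
      using J by (simp add: finite_cartesian_product_iff infinite_imp_nonempty)
    ultimately have "|?L| \<le>o |J|"
      using card_of_lists_infinite ordLeq_ordIso_trans by blast
    then show ?thesis using card_of_image ordLeq_transitive by blast
  qed
  ultimately show thesis by (rule that)
qed

text \<open>The unit vectors with index in \<open>W\<close> form a discrete set: the box around
  \<open>e w\<close> contains no other \<open>e v\<close>, so distinct indices need distinct basic
  sets.\<close>

lemma card_le_base_between:
  fixes S :: "('i \<Rightarrow> real) set"
  assumes S: "sigma_cube J \<subseteq> S" and W: "W \<subseteq> J" and \<B>: "is_base (top_of_set S) \<B>"
  shows "|W| \<le>o |\<B>|"
proof -
  define e where "e w = (\<lambda>i. if i = w then 1 else 0 :: real)" for w :: 'i
  have eS: "e w \<in> S" if "w \<in> W" for w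
  proof -
    have "{i. e w i \<noteq> 0} = {w}" by (auto simp: e_def)
    then have "e w \<in> sigma_cube J"
      using that W by (auto simp: e_def sigma_cube_def cube_on_def)
    then show ?thesis using S by blast
  qed
  have "\<exists>V\<in>\<B>. e w \<in> V \<and> V \<subseteq> {z \<in> S. \<forall>i\<in>{w}. \<bar>z i - 1\<bar> < 1}" if "w \<in> W" for w
  proof -
    have "openin (top_of_set S) {z \<in> S. \<forall>i\<in>{w}. \<bar>z i - 1\<bar> < 1}"
      using openin_coordinate_box[of "{w}" S "\<lambda>_. 1" 1] by simp
    moreover have "e w \<in> {z \<in> S. \<forall>i\<in>{w}. \<bar>z i - 1\<bar> < 1}"
      using eS[OF that] by (simp add: e_def)
    ultimately show ?thesis
      using \<B> unfolding is_base_def by blast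
  qed
  then have "\<forall>w\<in>W. \<exists>V. V \<in> \<B> \<and> e w \<in> V \<and> V \<subseteq> {z \<in> S. \<forall>i\<in>{w}. \<bar>z i - 1\<bar> < 1}" by blast
  then obtain V where V: "\<forall>w\<in>W. V w \<in> \<B> \<and> e w \<in> V w \<and> V w \<subseteq> {z \<in> S. \<forall>i\<in>{w}. \<bar>z i - 1\<bar> < 1}"
    by (rule bchoice[THEN exE])
  have "inj_on V W"
  proof (rule inj_onI)
    fix v w assume vw: "v \<in> W" "w \<in> W" "V v = V w"
    then have "\<bar>e v w - 1\<bar> < 1" using V by blast
    then show "v = w" by (auto simp: e_def split: if_splits)
  qed
  then show ?thesis
    using V card_of_ordLeq by blast
qed

subsection \<open>Embedding \<open>X\<close>\<close>

text \<open>A coordinate for each pair \<open>(U, V)\<close> of basic sets for which some \<open>f\<close> is small on \<open>U\<close> and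
  equals \<open>1\<close> off \<open>V\<close>; the other coordinates are junk.\<close>

lemma tychonoff_separating_family:
  fixes X :: "'a topology"
  assumes X: "completely_regular_space X" and \<B>: "is_base X \<B>"
  obtains \<phi> :: "'a set \<times> 'a set \<Rightarrow> 'a \<Rightarrow> real" where
    "\<forall>k. continuous_map X (top_of_set {0..1}) (\<phi> k)"
    "\<forall>U x. openin X U \<and> x \<in> U \<longrightarrow> (\<exists>k\<in>\<B> \<times> \<B>. \<phi> k x < 1/2 \<and> (\<forall>y\<in>topspace X - U. \<phi> k y = 1))"
proof -
  define ok where "ok k f \<longleftrightarrow> continuous_map X (top_of_set {0..1}) f \<and>
      (\<forall>y\<in>fst k. f y < 1/2) \<and> (\<forall>y\<in>topspace X - snd k. f y = 1)"
    for k :: "'a set \<times> 'a set" and f :: "'a \<Rightarrow> real"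
  define \<phi> where "\<phi> k = (if \<exists>f. ok k f then SOME f. ok k f else (\<lambda>_. 0))" for k
  have ok: "ok k (\<phi> k)" if "ok k f" for k f
    using that someI[of "ok k" f] by (auto simp: \<phi>_def)
  show thesis
  proof (rule that[of \<phi>], intro allI)
    show "continuous_map X (top_of_set {0..1}) (\<phi> k)" for k
    proof (cases "\<exists>f. ok k f")
      case True
      then show ?thesis using ok unfolding ok_def by blast
    next
      case False
      then show ?thesis by (simp add: \<phi>_def)
    qed
    show "\<forall>U x. openin X U \<and> x \<in> U \<longrightarrow> (\<exists>k\<in>\<B> \<times> \<B>. \<phi> k x < 1/2 \<and> (\<forall>y\<in>topspace X - U. \<phi> k y = 1))"
    proof (intro allI impI)
      fix U x assume "openin X U \<and> x \<in> U"
      then obtain V where V: "V \<in> \<B>" "x \<in> V" "V \<subseteq> U" "openin X V"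
        using \<B> unfolding is_base_def by blast
      then have "closedin X (topspace X - V)" "x \<in> topspace X - (topspace X - V)"
        using openin_subset by fastforce+
      then obtain f where f: "continuous_map X (top_of_set {0..1}) f" "f x = 0" "f ` (topspace X - V) \<subseteq> {1::real}"
        using X unfolding completely_regular_space_def by meson
      have "continuous_map X euclideanreal f"
        using f(1) by (simp add: continuous_map_in_subtopology)
      then have "openin X {z \<in> topspace X. f z \<in> {..<1/2}}"
        by (rule openin_continuous_map_preimage) simp
      moreover have "x \<in> {z \<in> topspace X. f z \<in> {..<1/2}}"
        using f(2) V openin_subset by fastforce
      ultimately obtain U' where U': "U' \<in> \<B>" "x \<in> U'" "U' \<subseteq> {z \<in> topspace X. f z \<in> {..<1/2}}"
        using \<B> unfolding is_base_def by meson
      \<comment> \<open>The function \<open>f\<close> depends on \<open>x\<close> and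
        \<open>U\<close>, but any function chosen for the pair \<open>(U', V)\<close> separates
        \<open>x\<close> from the complement of \<open>U\<close> just as well. This keeps the number
        of coordinates down to that of pairs of basic sets.\<close>
      have "ok (U', V) f"
        using f U' by (auto simp: ok_def)
      then have "ok (U', V) (\<phi> (U', V))" by (rule ok)
      then show "\<exists>k\<in>\<B> \<times> \<B>. \<phi> k x < 1/2 \<and> (\<forall>y\<in>topspace X - U. \<phi> k y = 1)"
        using U' V by (intro bexI[of _ "(U', V)"]) (auto simp: ok_def)
    qed
  qed
qed

text \<open>The classical evaluation map, with coordinates named through \<open>e\<close> by pairs
  of basic sets, and further coordinates in \<open>W\<close> held at 1 to mark the image.\<close>

lemma tychonoff_cube_embedding:
  fixes X :: "'a topology" and e :: "'a set \<times> 'a set \<Rightarrow> 'i"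
  assumes X: "tychonoff_space X" and \<B>: "is_base X \<B>"
    and e: "inj_on e (\<B> \<times> \<B>)" "e ` (\<B> \<times> \<B>) \<inter> W = {}"
  obtains f where "embedding_map X euclidean f"
    "\<forall>x\<in>topspace X. f x \<in> cube_on (e ` (\<B> \<times> \<B>) \<union> W) \<and> (\<forall>w\<in>W. f x w = (1::real))"
proof -
  obtain \<phi> where \<phi>: "\<forall>k. continuous_map X (top_of_set {0..1::real}) (\<phi> k)"
    "\<forall>U x. openin X U \<and> x \<in> U \<longrightarrow> (\<exists>k\<in>\<B> \<times> \<B>. \<phi> k x < 1/2 \<and> (\<forall>y\<in>topspace X - U. \<phi> k y = 1))"
    using tychonoff_separating_family X \<B> unfolding tychonoff_space_def by metis
  define f where "f x i = (if i \<in> e ` (\<B> \<times> \<B>) then \<phi> (inv_into (\<B> \<times> \<B>) e i) x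
      else if i \<in> W then 1 else 0)" for x i
  have fe: "f x (e k) = \<phi> k x" if "k \<in> \<B> \<times> \<B>" for x k
    using that e(1) by (simp add: f_def)
  have range: "\<phi> k x \<in> {0..1}" if "x \<in> topspace X" for k x
    using \<phi>(1)[rule_format, of k] that by (auto simp: continuous_map_in_subtopology)
  have sep: "\<exists>k\<in>\<B> \<times> \<B>. f x (e k) < 1/2 \<and> (\<forall>y\<in>topspace X - U. f y (e k) = 1)"
    if "openin X U" "x \<in> U" for U x
    using \<phi>(2) that fe by metis
  have inj: "inj_on f (topspace X)"
  proof (rule inj_onI, rule ccontr)
    fix x y assume xy: "x \<in> topspace X" "y \<in> topspace X" "f x = f y" "x \<noteq> y"
    then obtain U where "openin X U" "x \<in> U" "y \<notin> U"
      using X unfolding tychonoff_space_def Hausdorff_space_def disjnt_def by blast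
    with sep[of U x] xy show False by fastforce
  qed
  have "continuous_map X euclideanreal (\<lambda>x. f x i)" for i
    using \<phi>(1)[rule_format, of "inv_into (\<B> \<times> \<B>) e i"]
    by (simp add: f_def continuous_map_in_subtopology)
  then have "continuous_map X (product_topology (\<lambda>i. euclidean) UNIV) f"
    by (simp add: continuous_map_componentwise_UNIV)
  then have cont: "continuous_map X euclidean f"
    by (simp add: euclidean_product_topology)
  have "homeomorphic_map X (top_of_set (f ` topspace X)) f"
  proof (rule bijective_open_imp_homeomorphic_map)
    show "open_map X (top_of_set (f ` topspace X)) f"
      unfolding open_map_def
    proof (intro allI impI)
      fix U assume U: "openin X U"
      show "openin (top_of_set (f ` topspace X)) (f ` U)"
      proof (subst openin_subopen, intro ballI)
        fix z assume "z \<in> f ` U"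
        then obtain x where x: "x \<in> U" "z = f x" by blast
        obtain k where k: "f x (e k) < 1/2" "\<forall>y\<in>topspace X - U. f y (e k) = 1"
          using sep[OF U x(1)] by blast
        \<comment> \<open>This half-space contains \<open>f x\<close> and misses the image of the
          complement of \<open>U\<close>, so it cuts out of the image a neighbourhood of
          \<open>z\<close> inside that of \<open>U\<close>.\<close>
        have "open {z :: 'i \<Rightarrow> real. z (e k) < 1/2}"
          by (intro open_Collect_less continuous_on_product_coordinates continuous_on_const)
        then have "openin (top_of_set (f ` topspace X)) (f ` topspace X \<inter> {z. z (e k) < 1/2})"
          by blast
        moreover have "f ` topspace X \<inter> {z. z (e k) < 1/2} \<subseteq> f ` U"
          using k(2) by force
        moreover have "z \<in> f ` topspace X \<inter> {z. z (e k) < 1/2}"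
          using x k(1) openin_subset[OF U] by auto
        ultimately show "\<exists>T. openin (top_of_set (f ` topspace X)) T \<and> z \<in> T \<and> T \<subseteq> f ` U"
          by blast
      qed
    qed
  qed (use cont inj in \<open>auto simp: continuous_map_in_subtopology\<close>)
  then have "embedding_map X euclidean f"
    by (simp add: embedding_map_def)
  moreover have "f x \<in> cube_on (e ` (\<B> \<times> \<B>) \<union> W) \<and> (\<forall>w\<in>W. f x w = 1)" if "x \<in> topspace X" for x
  proof -
    have "f x w = 1" if "w \<in> W" for w
      using that e(2) unfolding f_def by (metis IntI empty_iff)
    then show ?thesis
      using range[OF \<open>x \<in> topspace X\<close>] by (auto simp: f_def cube_on_def)
  qed
  ultimately show thesis using that by blast
qed

text \<open>Preimages of the members of \<B> form a base of \<open>X\<close>. This makes weight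
  monotone under embeddings.\<close>

lemma embedding_map_base:
  assumes f: "embedding_map X Y f" and \<B>: "is_base Y \<B>"
  obtains \<B>' where "is_base X \<B>'" "|\<B>'| \<le>o |\<B>|"
proof -
  have hom: "homeomorphic_map X (subtopology Y (f ` topspace X)) f"
    using f by (simp add: embedding_map_def)
  then have cont: "continuous_map X Y f" and inj: "inj_on f (topspace X)"
    by (auto dest: homeomorphic_imp_continuous_map homeomorphic_imp_injective_map
        simp: continuous_map_in_subtopology)
  let ?g = "\<lambda>V. {x \<in> topspace X. f x \<in> V}"
  have "is_base X (?g ` \<B>)"
    unfolding is_base_def
  proof (intro conjI ballI allI impI)
    show "openin X V" if "V \<in> ?g ` \<B>" for V
      using that \<B> openin_continuous_map_preimage[OF cont] unfolding is_base_def by blast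
    fix U x assume U: "openin X U \<and> x \<in> U"
    then have "openin (subtopology Y (f ` topspace X)) (f ` U)"
      using hom homeomorphic_imp_open_map open_map_def by blast
    then obtain T where T: "openin Y T" "f ` U = T \<inter> f ` topspace X"
      by (auto simp: openin_subtopology)
    then have "f x \<in> T" using U by blast
    with T(1) obtain V where V: "V \<in> \<B>" "f x \<in> V" "V \<subseteq> T"
      using \<B> unfolding is_base_def by meson
    have "?g V \<subseteq> U"
    proof
      fix y assume y: "y \<in> ?g V"
      then have "f y \<in> f ` U" using V T by blast
      then show "y \<in> U"
        using y inj openin_subset U by (metis (no_types, lifting) inj_on_image_mem_iff mem_Collect_eq)
    qed
    moreover have "x \<in> ?g V"
      using V U openin_subset by blast
    ultimately show "\<exists>W\<in>?g ` \<B>. x \<in> W \<and> W \<subseteq> U"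
      using V(1) by blast
  qed
  then show thesis
    using that card_of_image by blast
qed

section \<open>Compactness properties of the union of \<Sigma> with a continuous image of
  \<open>X\<close>\<close>

lemma strict_mono_subsequence_Un:
  assumes "\<And>n::nat. y n \<in> P \<union> Q"
  obtains r :: "nat \<Rightarrow> nat" where "strict_mono r" "(\<forall>n. y (r n) \<in> P) \<or> (\<forall>n. y (r n) \<in> Q)"
proof -
  have "UNIV = {n. y n \<in> P} \<union> {n. y n \<in> Q}"
    using assms by blast
  then have "infinite {n. y n \<in> P} \<or> infinite {n. y n \<in> Q}"
    by (metis finite_Un infinite_UNIV_nat)
  then show thesis
    using infinite_enumerate[of "{n. y n \<in> P}"] infinite_enumerate[of "{n. y n \<in> Q}"] that by blast
qed

lemma compactin_closure_of_subset:
  assumes "Hausdorff_space Y" "compactin Y K" "R \<subseteq> K"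
  shows "compactin Y (Y closure_of R)"
  using assms closed_compactin[OF assms(2)] closure_of_minimal[OF assms(3)]
    compactin_imp_closedin[OF assms(1,2)] by simp

lemma infinite_subsequence:
  assumes "strict_mono (r :: nat \<Rightarrow> nat)" "infinite {n. P (r n)}"
  shows "infinite {n. P n}"
  using assms finite_vimageI[of "{n. P n}" r] by (auto simp: vimage_def strict_mono_imp_inj_on)

context
  fixes X :: "'a topology" and f :: "'a \<Rightarrow> 'i \<Rightarrow> real" and J :: "'i set" and Y
  defines "Y \<equiv> top_of_set (sigma_cube J \<union> f ` topspace X)"
  assumes f: "continuous_map X Y f"
begin

text \<open>One of the two pieces receives infinitely many terms. In the second case they are pulled
  back to a sequence in \<open>X\<close>, to which the property of \<open>X\<close> applies.\<close>

lemma sequence_casesE [consumes 1]: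
  fixes y :: "nat \<Rightarrow> 'i \<Rightarrow> real"
  assumes "range y \<subseteq> topspace Y"
  obtains (sigma) r :: "nat \<Rightarrow> nat" where "strict_mono r" "\<forall>n. y (r n) \<in> sigma_cube J"
  | (image) r :: "nat \<Rightarrow> nat" and a where "strict_mono r" "range a \<subseteq> topspace X" "y \<circ> r = f \<circ> a"
proof -
  have y: "y n \<in> sigma_cube J \<union> f ` topspace X" for n
    using assms by (auto simp: Y_def)
  obtain r :: "nat \<Rightarrow> nat" where r: "strict_mono r"
    "(\<forall>n. y (r n) \<in> sigma_cube J) \<or> (\<forall>n. y (r n) \<in> f ` topspace X)"
    using strict_mono_subsequence_Un[of y "sigma_cube J" "f ` topspace X", OF y] .
  from r(2) show thesis
  proof
    assume "\<forall>n. y (r n) \<in> f ` topspace X"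
    then have "\<forall>n. \<exists>a. a \<in> topspace X \<and> y (r n) = f a" by blast
    then obtain a where "\<forall>n. a n \<in> topspace X \<and> y (r n) = f (a n)"
      by (rule choice[THEN exE])
    then show thesis
      using image[OF r(1), of a] by (auto simp: fun_eq_iff)
  qed (use sigma r(1) in blast)
qed

lemma sigma_subsequence_limitin:
  fixes y :: "nat \<Rightarrow> 'i \<Rightarrow> real"
  assumes "\<forall>n. y n \<in> sigma_cube J"
  obtains r l where "strict_mono r" "limitin Y (y \<circ> r) l sequentially"
proof -
  obtain r l where "strict_mono r" "l \<in> sigma_cube J" "\<forall>i. (\<lambda>n. y (r n) i) \<longlonglongrightarrow> l i"
    using sigma_cube_convergent_subsequence[of y J] assms by blast
  moreover from this have "limitin Y (y \<circ> r) l sequentially"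
    using assms unfolding Y_def by (intro limitin_coordinatewise) auto
  ultimately show thesis using that by blast
qed

lemma sigma_sequence_compactin:
  fixes y :: "nat \<Rightarrow> 'i \<Rightarrow> real"
  assumes "\<forall>n. y n \<in> sigma_cube J"
  obtains C where "compactin Y C" "range y \<subseteq> C"
proof -
  obtain A where "countable A" "A \<subseteq> J" "\<forall>n. y n \<in> cube_on A"
    using sigma_cube_support_UN[of y J] assms by blast
  then show thesis
    using cube_on_countable_subset[of A J] compact_cube_on[of A]
    by (intro that[of "cube_on A"]) (auto simp: Y_def compactin_subtopology)
qed

lemma Hausdorff_Y: "Hausdorff_space Y"
  using tychonoff_top_of_set unfolding Y_def tychonoff_space_def by blast

lemma sequentially_compact_extension:
  assumes X: "sequentially_compact_space X"
  shows "sequentially_compact_space Y"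
  unfolding sequentially_compact_space_def
proof (intro allI impI)
  fix y :: "nat \<Rightarrow> 'i \<Rightarrow> real" assume "range y \<subseteq> topspace Y"
  then show "\<exists>r l. strict_mono r \<and> limitin Y (y \<circ> r) l sequentially"
  proof (cases rule: sequence_casesE)
    case (sigma r)
    then have "\<forall>n. (y \<circ> r) n \<in> sigma_cube J" by simp
    then obtain s l where "strict_mono s" "limitin Y ((y \<circ> r) \<circ> s) l sequentially"
      by (rule sigma_subsequence_limitin)
    then show ?thesis
      using sigma(1) strict_mono_o by (metis comp_assoc)
  next
    case (image r a)
    obtain s l where "strict_mono s" "limitin X (a \<circ> s) l sequentially"
      using X image(2) unfolding sequentially_compact_space_def by blast
    moreover have "y \<circ> (r \<circ> s) = f \<circ> (a \<circ> s)"
      using image(3) by (simp flip: comp_assoc)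
    ultimately show ?thesis
      using continuous_map_limit[OF f] image(1) strict_mono_o by metis
  qed
qed

lemma countably_compact_extension:
  assumes X: "countably_compact_space X"
  shows "countably_compact_space Y"
  unfolding countably_compact_space_def
proof (intro allI impI)
  fix y :: "nat \<Rightarrow> 'i \<Rightarrow> real" assume "range y \<subseteq> topspace Y"
  then show "\<exists>l\<in>topspace Y. \<forall>U. openin Y U \<and> l \<in> U \<longrightarrow> infinite {n. y n \<in> U}"
  proof (cases rule: sequence_casesE)
    case (sigma r)
    then have "\<forall>n. (y \<circ> r) n \<in> sigma_cube J" by simp
    then obtain s l where s: "strict_mono s" "limitin Y ((y \<circ> r) \<circ> s) l sequentially"
      by (rule sigma_subsequence_limitin)
    have "infinite {n. y n \<in> U}" if U: "openin Y U" "l \<in> U" for U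
    proof -
      have "\<forall>\<^sub>F n in sequentially. y ((r \<circ> s) n) \<in> U"
        using s(2) U by (auto simp: limitin_def)
      then have "infinite {n. y ((r \<circ> s) n) \<in> U}"
        by (metis (full_types) eventually_sequentially infinite_nat_iff_unbounded_le mem_Collect_eq nle_le)
      then show ?thesis
        using infinite_subsequence[of "r \<circ> s" "\<lambda>n. y n \<in> U"] sigma(1) s(1) strict_mono_o by blast
    qed
    then show ?thesis
      using limitin_topspace[OF s(2)] by blast
  next
    case (image r a)
    obtain l where l: "l \<in> topspace X" "\<forall>U. openin X U \<and> l \<in> U \<longrightarrow> infinite {n. a n \<in> U}"
      using X image(2) unfolding countably_compact_space_def by blast
    have "infinite {n. y n \<in> U}" if U: "openin Y U" "f l \<in> U" for U
    proof -
      have "openin X {x \<in> topspace X. f x \<in> U}" "l \<in> {x \<in> topspace X. f x \<in> U}"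
        using l(1) U(2) openin_continuous_map_preimage[OF f U(1)] by auto
      then have "infinite {n. a n \<in> {x \<in> topspace X. f x \<in> U}}"
        using l(2) by blast
      moreover have "y (r n) = f (a n)" for n
        using image(3) by (metis o_apply)
      then have "{n. a n \<in> {x \<in> topspace X. f x \<in> U}} \<subseteq> {n. y (r n) \<in> U}"
        by auto
      ultimately have "infinite {n. y (r n) \<in> U}"
        using infinite_super by blast
      then show ?thesis
        using infinite_subsequence[of r "\<lambda>n. y n \<in> U"] image(1) by blast
    qed
    moreover have "f l \<in> topspace Y"
      using l(1) f by (auto simp: continuous_map_def)
    ultimately show ?thesis by blast
  qed
qed

lemma totally_countably_compact_extension:
  assumes X: "totally_countably_compact_space X"
  shows "totally_countably_compact_space Y"
  unfolding totally_countably_compact_space_def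
proof (intro allI impI)
  fix y :: "nat \<Rightarrow> 'i \<Rightarrow> real" assume "range y \<subseteq> topspace Y"
  then show "\<exists>r :: nat \<Rightarrow> nat. strict_mono r \<and> compactin Y (Y closure_of range (y \<circ> r))"
  proof (cases rule: sequence_casesE)
    case (sigma r)
    then have "\<forall>n. (y \<circ> r) n \<in> sigma_cube J" by simp
    then obtain C where "compactin Y C" "range (y \<circ> r) \<subseteq> C"
      by (rule sigma_sequence_compactin)
    then have "compactin Y (Y closure_of range (y \<circ> r))"
      by (rule compactin_closure_of_subset[OF Hausdorff_Y])
    then show ?thesis
      using sigma(1) by metis
  next
    case (image r a)
    obtain s :: "nat \<Rightarrow> nat" where s: "strict_mono s" "compactin X (X closure_of range (a \<circ> s))"
      using X image(2) unfolding totally_countably_compact_space_def by blast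
    have "range (a \<circ> s) \<subseteq> X closure_of range (a \<circ> s)"
      using image(2) by (intro closure_of_subset) auto
    then have "range (y \<circ> (r \<circ> s)) \<subseteq> f ` (X closure_of range (a \<circ> s))"
      using image(3) by (force simp: fun_eq_iff)
    then have "compactin Y (Y closure_of range (y \<circ> (r \<circ> s)))"
      by (rule compactin_closure_of_subset[OF Hausdorff_Y image_compactin[OF s(2) f]])
    then show ?thesis
      using strict_mono_o[OF image(1) s(1)] by metis
  qed
qed

text \<open>The whole range needs compact closure, so passing to a subsequence is no option. Instead
  each of the two parts of the range is covered by a compact set, after the terms outside it are
  replaced by a default point: the zero function in \<Sigma>, and \<open>x0\<close> in
  \<open>X\<close>.\<close>

lemma omega_bounded_extension:
  assumes X: "omega_bounded_space X"
  shows "omega_bounded_space Y"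
  unfolding omega_bounded_space_def
proof (intro allI impI)
  fix y :: "nat \<Rightarrow> 'i \<Rightarrow> real" assume y: "range y \<subseteq> topspace Y"
  have "\<exists>C. compactin Y C \<and> range y \<inter> sigma_cube J \<subseteq> C"
  proof -
    define u where "u n = (if y n \<in> sigma_cube J then y n else (\<lambda>_. 0))" for n
    have "\<forall>n. u n \<in> sigma_cube J"
      by (simp add: u_def sigma_cube_def cube_on_def)
    then obtain C where "compactin Y C" "range u \<subseteq> C"
      by (rule sigma_sequence_compactin)
    moreover have "range y \<inter> sigma_cube J \<subseteq> range u"
      by (force simp: u_def)
    ultimately show ?thesis by blast
  qed
  moreover have "\<exists>C. compactin Y C \<and> range y \<inter> f ` topspace X \<subseteq> C"
  proof (cases "topspace X = {}")
    case False
    then obtain x0 where x0: "x0 \<in> topspace X" by blast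
    define a where "a n = (if y n \<in> f ` topspace X then inv_into (topspace X) f (y n) else x0)" for n
    have a: "range a \<subseteq> topspace X"
      using x0 by (auto simp: a_def inv_into_into)
    then have "range a \<subseteq> X closure_of range a"
      by (rule closure_of_subset)
    moreover have "range y \<inter> f ` topspace X \<subseteq> f ` range a"
    proof
      fix z assume "z \<in> range y \<inter> f ` topspace X"
      then obtain n where "z = y n" "y n \<in> f ` topspace X" by blast
      then have "z = f (a n)" by (simp add: a_def f_inv_into_f)
      then show "z \<in> f ` range a" by blast
    qed
    moreover have "compactin Y (f ` (X closure_of range a))"
      using X a image_compactin[OF _ f] unfolding omega_bounded_space_def by blast
    ultimately show ?thesis by blast
  qed (auto intro: exI[of _ "{}"])
  ultimately obtain C D where CD: "compactin Y C" "range y \<inter> sigma_cube J \<subseteq> C"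
    "compactin Y D" "range y \<inter> f ` topspace X \<subseteq> D" by blast
  have "range y \<subseteq> sigma_cube J \<union> f ` topspace X"
    using y by (simp add: Y_def)
  then have "range y \<subseteq> C \<union> D"
    using CD(2,4) by blast
  then show "compactin Y (Y closure_of range y)"
    by (rule compactin_closure_of_subset[OF Hausdorff_Y compactin_Un[OF CD(1,3)]])
qed

end

section \<open>Cardinalities of the index set and the weight\<close>

lemma Cinfinite_aleph_2: "Cinfinite aleph_2"
  unfolding aleph_2_def by (intro Cinfinite_cardSuc natLeq_Cinfinite)

lemma uncountable_aleph_2:
  assumes "|W| =o aleph_2"
  shows "uncountable W"
proof
  assume "countable W"
  then have "aleph_2 \<le>o natLeq"
    using assms countable_card_le_natLeq by (metis ordIso_ordLeq_trans ordIso_symmetric)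
  moreover have "natLeq <o cardSuc natLeq" "cardSuc natLeq <o aleph_2"
    unfolding aleph_2_def by (auto simp: cardSuc_Card_order cardSuc_greater natLeq_Card_order)
  ultimately show False
    using not_ordLess_ordLeq ordLess_transitive by blast
qed

text \<open>Infinite cardinals absorb products and sums. With the cardinal of the host type as
  \<open>r\<close> this places the index set in that type; with \<open>weight X\<close> or
  \<open>aleph_2\<close> it bounds the weight of \<open>Y\<close>.\<close>

lemma card_of_index_set:
  assumes r: "Card_order r" "|\<B>| \<le>o r" "aleph_2 \<le>o r"
  shows "|(\<B> \<times> \<B>) <+> Field aleph_2| \<le>o r"
proof -
  have "infinite (Field r)"
    using cinfinite_mono[OF r(3)] Cinfinite_aleph_2 by (simp add: cinfinite_def)
  moreover have "|Field aleph_2| \<le>o r"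
    using r(3) Cinfinite_aleph_2 card_of_Field_ordIso ordIso_ordLeq_trans by blast
  ultimately show ?thesis
    using r by (intro card_of_Plus_ordLeq_infinite_Field card_of_Times_ordLeq_infinite_Field)
qed

lemma index_set_injection:
  fixes \<B> :: "'a set set"
  obtains h :: "('a set \<times> 'a set) + nat set set \<Rightarrow> 'a set + nat set set"
  where "inj_on h ((\<B> \<times> \<B>) <+> Field aleph_2)"
proof -
  let ?T = "UNIV :: ('a set + nat set set) set"
  have "|\<B>| \<le>o |?T|"
    unfolding card_of_ordLeq[symmetric] by (intro exI[of _ Inl]) auto
  moreover have "|Field aleph_2| \<le>o |?T|"
    unfolding card_of_ordLeq[symmetric] by (intro exI[of _ Inr]) auto
  then have "aleph_2 \<le>o |?T|"
    using Cinfinite_aleph_2 card_of_Field_ordIso ordIso_symmetric ordIso_ordLeq_trans by blast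
  ultimately have "|(\<B> \<times> \<B>) <+> Field aleph_2| \<le>o |?T|"
    by (intro card_of_index_set card_of_Card_order)
  then show thesis
    unfolding card_of_ordLeq[symmetric] using that by blast
qed

lemma weight_le_base: "is_base X \<B> \<Longrightarrow> weight X \<le>o |\<B>|"
  using weight_attained[of X] by (auto simp: is_min_base_def)

lemma Card_order_weight: "Card_order (weight X)"
  unfolding weight_def by (rule card_of_Card_order)

section \<open>Construction of \<open>Y\<close> for nonempty \<open>X\<close>\<close>

lemma extension_nonempty:
  fixes X :: "'a topology"
  assumes X: "tychonoff_space X" "topspace X \<noteq> {}"
  shows "\<exists>Y :: 'a cube topology.
           tychonoff_space Y \<and> closely_embedded X Y \<and>
           pseudocompact_space Y \<and> ascoli_space Y \<and>
           \<not> k_real_space Y \<and>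
           is_card_max (weight Y) (weight X) aleph_2 \<and>
           near_sequentially_compact_space Y \<and>
           (omega_bounded_space X \<longrightarrow> omega_bounded_space Y) \<and>
           (sequentially_compact_space X \<longrightarrow> sequentially_compact_space Y) \<and>
           (totally_countably_compact_space X \<longrightarrow> totally_countably_compact_space Y) \<and>
           (countably_compact_space X \<longrightarrow> countably_compact_space Y)"
proof -
  obtain \<B> where \<B>: "is_base X \<B>" "weight X = |\<B>|"
    using weight_attained[of X] by (auto simp: is_min_base_def)
  obtain h :: "('a set \<times> 'a set) + nat set set \<Rightarrow> 'a set + nat set set"
    where h: "inj_on h ((\<B> \<times> \<B>) <+> Field aleph_2)"
    by (rule index_set_injection)
  \<comment> \<open>The two halves of the injection \<open>h\<close> give disjoint sets of
    coordinates: one for embedding \<open>X\<close>, one of cardinality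
    \<open>aleph_2\<close>.\<close>
  define e where "e = h \<circ> Inl"
  define W where "W = (h \<circ> Inr) ` Field aleph_2"
  define J where "J = e ` (\<B> \<times> \<B>) \<union> W"
  have e: "inj_on e (\<B> \<times> \<B>)" "e ` (\<B> \<times> \<B>) \<inter> W = {}"
    using h by (auto simp: e_def W_def inj_on_def)
  have "inj_on (h \<circ> Inr) (Field aleph_2)"
    using h by (auto simp: inj_on_def)
  then have "|Field aleph_2| =o |W|"
    by (intro card_of_ordIsoI[of "h \<circ> Inr"]) (simp add: W_def bij_betw_def)
  then have W: "|W| =o aleph_2"
    using Cinfinite_aleph_2 card_of_Field_ordIso ordIso_symmetric ordIso_transitive by blast
  note unc = uncountable_aleph_2[OF W]
  have "infinite W" using unc countable_finite by blast
  then have J: "infinite J" "W \<subseteq> J" by (auto simp: J_def)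
  have "J = h ` ((\<B> \<times> \<B>) <+> Field aleph_2)"
    by (force simp: J_def e_def W_def)
  then have Jle: "|J| \<le>o |(\<B> \<times> \<B>) <+> Field aleph_2|"
    using card_of_image by blast
  obtain f where f: "embedding_map X euclidean f"
    "\<forall>x\<in>topspace X. f x \<in> cube_on J \<and> (\<forall>w\<in>W. f x w = (1::real))"
    using tychonoff_cube_embedding[OF X(1) \<B>(1) e] unfolding J_def by blast
  define F where "F = f ` topspace X"
  define S where "S = sigma_cube J \<union> F"
  define Y where "Y = top_of_set S"
  \<comment> \<open>Nonemptiness of \<open>X\<close> enters here: the indicator of \<open>F\<close>
    is discontinuous only if \<open>F\<close> has a point.\<close>
  have F: "F \<noteq> {}" "F \<subseteq> cube_on J" "\<forall>y\<in>F. \<forall>w\<in>W. y w = 1"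
    using f(2) X(2) by (auto simp: F_def)
  have S: "sigma_cube J \<subseteq> S" "S \<subseteq> cube_on J"
    using F(2) sigma_cube_subset by (auto simp: S_def)
  have emb: "embedding_map X Y f"
    using f(1) unfolding Y_def by (simp add: embedding_map_in_subtopology S_def F_def)
  then have cont: "continuous_map X (top_of_set (sigma_cube J \<union> f ` topspace X)) f"
    unfolding Y_def S_def F_def
    by (auto simp: embedding_map_def continuous_map_in_subtopology dest: homeomorphic_imp_continuous_map)
  have closed: "closedin Y F"
  proof -
    have "F = S \<inter> (\<Inter>w\<in>W. {y. y w = 1})"
    proof (intro equalityI subsetI)
      fix y assume y: "y \<in> S \<inter> (\<Inter>w\<in>W. {y. y w = 1})"
      then have "y \<notin> sigma_cube J"
        using sigma_cube_not_one_on_uncountable[OF _ unc, of y J] by auto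
      then show "y \<in> F"
        using y by (simp add: S_def)
    qed (use F(3) S_def in auto)
    moreover have "closed {y :: 'a cube. y w = 1}" for w
      by (intro closed_Collect_eq continuous_on_product_coordinates continuous_on_const)
    then have "closed (\<Inter>w\<in>W. {y :: 'a cube. y w = 1})"
      by (intro closed_INT) simp
    ultimately show ?thesis
      unfolding Y_def closedin_closed by blast
  qed
  have near: "near_sequentially_compact_space Y"
    unfolding Y_def by (rule near_sequentially_compact_between[OF S])
  obtain \<C> where \<C>: "is_base Y \<C>" "weight Y = |\<C>|"
    using weight_attained[of Y] by (auto simp: is_min_base_def)
  have "weight X \<le>o weight Y"
  proof -
    obtain \<B>' where "is_base X \<B>'" "|\<B>'| \<le>o |\<C>|"
      using embedding_map_base[OF emb \<C>(1)] .
    then show ?thesis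
      unfolding \<C>(2) using weight_le_base ordLeq_transitive by blast
  qed
  moreover have "aleph_2 \<le>o weight Y"
    using card_le_base_between[OF S(1) J(2), of \<C>] \<C> W unfolding Y_def
    by (metis ordIso_ordLeq_trans ordIso_symmetric)
  moreover have "weight Y \<le>o weight X \<or> weight Y \<le>o aleph_2"
  proof -
    obtain \<D> where "is_base Y \<D>" "|\<D>| \<le>o |J|"
      using is_base_rational_boxes[OF S(2) J(1)] unfolding Y_def .
    then have upper: "weight Y \<le>o |(\<B> \<times> \<B>) <+> Field aleph_2|"
      using weight_le_base Jle ordLeq_transitive by metis
    have co: "Card_order (weight X)" "Card_order aleph_2"
      using Card_order_weight Cinfinite_aleph_2 by auto
    then have refl: "weight X \<le>o weight X" "aleph_2 \<le>o aleph_2"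
      by (auto simp: card_order_on_well_order_on ordLeq_reflexive)
    \<comment> \<open>Whichever of the two cardinals is larger dominates the index set, and with it
      the base of rational boxes.\<close>
    have "aleph_2 \<le>o weight X \<or> weight X \<le>o aleph_2"
      using co card_order_on_well_order_on ordLeq_total by metis
    then show ?thesis
    proof
      assume "aleph_2 \<le>o weight X"
      then have "|(\<B> \<times> \<B>) <+> Field aleph_2| \<le>o weight X"
        using card_of_index_set[OF co(1)] refl(1) \<B>(2) by simp
      then show ?thesis
        using ordLeq_transitive[OF upper] by blast
    next
      assume "weight X \<le>o aleph_2"
      then have "|(\<B> \<times> \<B>) <+> Field aleph_2| \<le>o aleph_2"
        using card_of_index_set[OF co(2)] refl(2) \<B>(2) by simp
      then show ?thesis
        using ordLeq_transitive[OF upper] by blast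
    qed
  qed
  ultimately have weight: "is_card_max (weight Y) (weight X) aleph_2"
    by (auto simp: is_card_max_def ordIso_iff_ordLeq)
  have Y_eq: "Y = top_of_set (sigma_cube J \<union> f ` topspace X)"
    by (simp add: Y_def S_def F_def)
  show ?thesis
  proof (intro exI[of _ Y] conjI impI)
    show "tychonoff_space Y" "ascoli_space Y"
      unfolding Y_def by (rule tychonoff_top_of_set, rule ascoli_between[OF S])
    show "closely_embedded X Y"
      using emb closed unfolding closely_embedded_def F_def by blast
    show "pseudocompact_space Y" "near_sequentially_compact_space Y"
      using near near_sequentially_compact_imp_pseudocompact by auto
    show "\<not> k_real_space Y"
      unfolding Y_def S_def by (rule not_k_real_between[OF F W unc])
    show "is_card_max (weight Y) (weight X) aleph_2" by (rule weight)
  qed (use Y_eq cont omega_bounded_extension sequentially_compact_extension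
      totally_countably_compact_extension countably_compact_extension in auto)
qed

text \<open>For \<open>X\<close> empty, \<open>Y\<close> would be \<open>\<Sigma>\<close>, which is a \<open>k\<^sub>\<real>\<close>-space.  A one-point space replaces \<open>X\<close>
  in this case.\<close>

theorem theorem3p13:
  fixes X :: "'a topology"
  assumes "tychonoff_space X"
  shows "\<exists>Y :: 'a cube topology.
           tychonoff_space Y \<and> closely_embedded X Y \<and>
           pseudocompact_space Y \<and> ascoli_space Y \<and>
           \<not> k_real_space Y \<and>
           is_card_max (weight Y) (weight X) aleph_2 \<and>
           (omega_bounded_space X \<longrightarrow> omega_bounded_space Y) \<and>
           (sequentially_compact_space X \<longrightarrow> sequentially_compact_space Y) \<and>
           (totally_countably_compact_space X \<longrightarrow> totally_countably_compact_space Y) \<and>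
           (near_sequentially_compact_space X \<longrightarrow> near_sequentially_compact_space Y) \<and>
           (countably_compact_space X \<longrightarrow> countably_compact_space Y)"
proof (cases "topspace X = {}")
  case False
  then show ?thesis
    using extension_nonempty[OF assms] by blast
next
  case True
  define P where "P = discrete_topology {undefined :: 'a}"
  have P: "tychonoff_space P" "topspace P \<noteq> {}"
    by (simp_all add: P_def tychonoff_space_def completely_regular_space_discrete_topology)
  obtain Y :: "'a cube topology" where Y: "tychonoff_space Y" "pseudocompact_space Y"
    "ascoli_space Y" "\<not> k_real_space Y" "is_card_max (weight Y) (weight P) aleph_2"
    "near_sequentially_compact_space Y"
    "omega_bounded_space P \<longrightarrow> omega_bounded_space Y"
    "sequentially_compact_space P \<longrightarrow> sequentially_compact_space Y"
    "totally_countably_compact_space P \<longrightarrow> totally_countably_compact_space Y"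
    "countably_compact_space P \<longrightarrow> countably_compact_space Y"
    using extension_nonempty[OF P] by blast
  have compact: "compactin P (P closure_of C)" for C
  proof -
    have "P closure_of C \<subseteq> {undefined}"
      using closure_of_subset_topspace[of P C] by (simp add: P_def)
    then show ?thesis
      using finite_subset by (intro finite_imp_compactin) (auto simp: P_def)
  qed
  have const: "x = (\<lambda>_. undefined)" if "range x \<subseteq> topspace P" for x :: "nat \<Rightarrow> 'a"
    using that by (auto simp: P_def)
  have "omega_bounded_space P"
    unfolding omega_bounded_space_def using compact by blast
  moreover have "totally_countably_compact_space P"
    unfolding totally_countably_compact_space_def using compact strict_mono_id by blast
  moreover have "sequentially_compact_space P"
    unfolding sequentially_compact_space_def
  proof (intro allI impI)
    fix x :: "nat \<Rightarrow> 'a" assume "range x \<subseteq> topspace P"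
    from const[OF this] show "\<exists>r l. strict_mono r \<and> limitin P (x \<circ> r) l sequentially"
      by (intro exI[of _ id] exI[of _ undefined]) (simp add: strict_mono_id o_def P_def limitin_const)
  qed
  moreover have "countably_compact_space P"
    unfolding countably_compact_space_def
  proof (intro allI impI)
    fix x :: "nat \<Rightarrow> 'a" assume "range x \<subseteq> topspace P"
    from const[OF this] show "\<exists>l\<in>topspace P. \<forall>U. openin P U \<and> l \<in> U \<longrightarrow> infinite {n. x n \<in> U}"
      by (simp add: P_def)
  qed
  moreover have "closely_embedded X Y"
    using True unfolding closely_embedded_def embedding_map_def
    by (intro exI[of _ "\<lambda>_. undefined"]) (simp add: null_topspace_iff_trivial homeomorphic_map_maps homeomorphic_maps_def)
  \<comment> \<open>\<open>P\<close> has weight at most 1 and the empty \<open>X\<close> has weight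
    0, so both maxima are \<open>aleph_2\<close>.\<close>
  moreover have "is_card_max (weight Y) (weight X) aleph_2"
  proof -
    have "is_base P {{undefined}}"
      unfolding is_base_def P_def by auto
    then have "weight P \<le>o |{{undefined :: 'a}}|"
      by (rule weight_le_base)
    moreover have "infinite (Field aleph_2)"
      using Cinfinite_aleph_2 by (simp add: cinfinite_def)
    then have "|{{undefined :: 'a}}| \<le>o |Field aleph_2|"
      by (intro card_of_singl_ordLeq infinite_imp_nonempty)
    moreover have "|Field aleph_2| =o aleph_2"
      using Cinfinite_aleph_2 card_of_Field_ordIso by blast
    ultimately have "weight P \<le>o aleph_2"
      using ordLeq_transitive ordLeq_ordIso_trans by metis
    then have "weight Y =o aleph_2"
      using Y(5) unfolding is_card_max_def
      by (metis ordIso_iff_ordLeq ordIso_ordLeq_trans)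
    moreover have "weight X \<le>o weight Y"
    proof -
      have "is_base X {}"
        using True openin_subset unfolding is_base_def by fastforce
      then have "weight X \<le>o |{} :: 'a set set|"
        by (rule weight_le_base)
      moreover have "|{} :: 'a set set| \<le>o weight Y"
        using card_of_empty1 Card_order_weight card_order_on_well_order_on by metis
      ultimately show ?thesis by (rule ordLeq_transitive)
    qed
    ultimately show ?thesis
      by (auto simp: is_card_max_def ordIso_iff_ordLeq)
  qed
  ultimately show ?thesis
    using Y by blast
qed

end
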